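(* Let $n\geq 1$. The HRT-Conjecture is equivalent to the statement that the Gabor spaces are fully interpolating. That is, the following two statements are equivalent: (i) (HRT) for every non-zero $g\in L^{2}(\mathbb{R}^{n})$, the set $\{M_{\omega}T_{x}g\}_{(x,\omega)\in\mathbb{R}^{2n}}$ is linearly independent in $L^{2}(\mathbb{R}^{n})$; (ii) for every $g\in L^{2}(\mathbb{R}^{n})$ with $\|g\|_{L^2(\mathbb{R}^n)}=1$, the Gabor space $V_{g}(L^{2}(\mathbb{R}^{n}))$ is fully interpolating.
   Context: For $x,\omega\in\mathbb{R}^n$, the time-shift and frequency-shift operators on $L^2(\mathbb{R}^n)$ are $T_xf(y):=f(y-x)$ and $M_\omega f(y):=e^{2\pi i y\cdot\omega}f(y)$. Linear independence of $\{M_\omega T_xg\}_{(x,\omega)\in\mathbb{R}^{2n}}$ means that for any finitely many distinct points $(x_1,\omega_1),\dots,(x_m,\omega_m)\in\mathbb{R}^{2n}$ the functions $M_{\omega_1}T_{x_1}g,\dots,M_{\omega_m}T_{x_m}g$ are linearly independent. The short-time Fourier transform is $V_gf(x,\omega):=\int_{\mathbb{R}^n}f(t)\overline{g(t-x)}e^{-2\pi i t\cdot\omega}\,dt=\langle f,M_\omega T_xg\rangle$ for $f,g\in L^2(\mathbb{R}^n)$ and $(x,\omega)\in\mathbb{R}^{2n}$. For $\|g\|=1$ the Gabor space is $V_g(L^2(\mathbb{R}^n)):=\{V_gf:f\in L^2(\mathbb{R}^n)\}\subset L^2(\mathbb{R}^{2n})$ with the $L^2(\mathbb{R}^{2n})$-norm;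 it is a reproducing kernel Hilbert space of functions on $\mathbb{R}^{2n}$ whose point kernel at $(x,\omega)$ (the element representing evaluation at $(x,\omega)$) is $k_{(x,\omega)}=V_g(M_\omega T_xg)$. A reproducing kernel Hilbert space on a set $X$ with reproducing kernel $K(x,y)=\langle k_y,k_x\rangle$ is fully interpolating if for every finite set of distinct points $x_1,\dots,x_m\in X$ the matrix $\{K(x_i,x_j)\}_{i,j=1}^m$ is strictly positive definite (equivalently, for all distinct $x_1,\dots,x_m\in X$ and all $\lambda_1,\dots,\lambda_m\in\mathbb{C}$ there is a function $F$ in the space with $F(x_i)=\lambda_i$ for all $i$). *)

theory Defs
  imports "HOL-Analysis.Analysis"
begin

section \<open>Square-integrable functions\<close>

text \<open>Elements of \<open>L\<^sup>2\<close> are handled through Borel measurable representatives; every Lebesgue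
  measurable function is almost everywhere equal to a Borel measurable one.  Equality in \<open>L\<^sup>2\<close> is
  equality almost everywhere.\<close>

definition L2 :: "('a::euclidean_space \<Rightarrow> complex) set" where
  "L2 = {f \<in> borel_measurable lborel. integrable lborel (\<lambda>t. (cmod (f t))\<^sup>2)}"

definition L2_inner :: "('a::euclidean_space \<Rightarrow> complex) \<Rightarrow> ('a \<Rightarrow> complex) \<Rightarrow> complex" where
  "L2_inner f h = (LINT t|lborel. f t * cnj (h t))"

definition L2_norm :: "('a::euclidean_space \<Rightarrow> complex) \<Rightarrow> real" where
  "L2_norm f = sqrt (LINT t|lborel. (cmod (f t))\<^sup>2)"

definition L2_nonzero :: "('a::euclidean_space \<Rightarrow> complex) \<Rightarrow> bool" where
  "L2_nonzero f \<longleftrightarrow> \<not> (AE t in lborel. f t = 0)"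

text \<open>Linear independence over the complex numbers, in \<open>L\<^sup>2\<close>, of an indexed family: distinct
  indices count as distinct members.\<close>

definition L2_lin_independent :: "('i \<Rightarrow> 'a::euclidean_space \<Rightarrow> complex) \<Rightarrow> bool" where
  "L2_lin_independent \<phi> \<longleftrightarrow>
    (\<forall>S c. finite S \<longrightarrow> (AE t in lborel. (\<Sum>i\<in>S. c i * \<phi> i t) = 0) \<longrightarrow> (\<forall>i\<in>S. c i = 0))"


section \<open>Time-frequency shifts and the short-time Fourier transform\<close>

definition time_shift :: "real^'n \<Rightarrow> (real^'n \<Rightarrow> complex) \<Rightarrow> real^'n \<Rightarrow> complex" where
  "time_shift x f = (\<lambda>y. f (y - x))"

definition freq_shift :: "real^'n \<Rightarrow> (real^'n \<Rightarrow> complex) \<Rightarrow> real^'n \<Rightarrow> complex" where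
  "freq_shift \<omega> f = (\<lambda>y. exp (2 * complex_of_real pi * \<i> * complex_of_real (y \<bullet> \<omega>)) * f y)"

definition stft ::
  "(real^'n \<Rightarrow> complex) \<Rightarrow> (real^'n \<Rightarrow> complex) \<Rightarrow> (real^'n) \<times> (real^'n) \<Rightarrow> complex" where
  "stft g f = (\<lambda>(x, \<omega>). LINT t|lborel.
     f t * cnj (g (t - x)) * exp (- 2 * complex_of_real pi * \<i> * complex_of_real (t \<bullet> \<omega>)))"

definition gabor_space :: "(real^'n \<Rightarrow> complex) \<Rightarrow> ((real^'n) \<times> (real^'n) \<Rightarrow> complex) set" where
  "gabor_space g = {stft g f | f. f \<in> L2}"


section \<open>Reproducing kernel Hilbert spaces of functions\<close>

text \<open>Inner products are linear in the first argument.  The functions in \<open>H\<close> are genuine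
  functions, so definiteness is with respect to pointwise equality.\<close>

definition inner_product_on ::
  "('x \<Rightarrow> complex) set \<Rightarrow> (('x \<Rightarrow> complex) \<Rightarrow> ('x \<Rightarrow> complex) \<Rightarrow> complex) \<Rightarrow> bool" where
  "inner_product_on H ip \<longleftrightarrow>
     (\<forall>F\<in>H. \<forall>G\<in>H. ip G F = cnj (ip F G)) \<and>
     (\<forall>F\<in>H. \<forall>G\<in>H. \<forall>E\<in>H. ip (\<lambda>x. F x + G x) E = ip F E + ip G E) \<and>
     (\<forall>F\<in>H. \<forall>E\<in>H. \<forall>c. ip (\<lambda>x. c * F x) E = c * ip F E) \<and>
     (\<forall>F\<in>H. F \<noteq> (\<lambda>x. 0) \<longrightarrow> ip F F \<in> \<real> \<and> 0 < Re (ip F F))"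

definition ip_dist ::
  "(('x \<Rightarrow> complex) \<Rightarrow> ('x \<Rightarrow> complex) \<Rightarrow> complex) \<Rightarrow> ('x \<Rightarrow> complex) \<Rightarrow> ('x \<Rightarrow> complex) \<Rightarrow> real" where
  "ip_dist ip F G = sqrt (Re (ip (\<lambda>x. F x - G x) (\<lambda>x. F x - G x)))"

definition hilbert_function_space ::
  "('x \<Rightarrow> complex) set \<Rightarrow> (('x \<Rightarrow> complex) \<Rightarrow> ('x \<Rightarrow> complex) \<Rightarrow> complex) \<Rightarrow> bool" where
  "hilbert_function_space H ip \<longleftrightarrow>
     (\<lambda>x. 0) \<in> H \<and>
     (\<forall>F\<in>H. \<forall>G\<in>H. (\<lambda>x. F x + G x) \<in> H) \<and>
     (\<forall>F\<in>H. \<forall>c. (\<lambda>x. c * F x) \<in> H) \<and>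
     inner_product_on H ip \<and>
     (\<forall>F :: nat \<Rightarrow> 'x \<Rightarrow> complex.
        (\<forall>n. F n \<in> H) \<and> (\<forall>e>0. \<exists>N. \<forall>m\<ge>N. \<forall>n\<ge>N. ip_dist ip (F m) (F n) < e) \<longrightarrow>
        (\<exists>G\<in>H. (\<lambda>n. ip_dist ip (F n) G) \<longlonglongrightarrow> 0))"

definition represents_evaluation ::
  "('x \<Rightarrow> complex) set \<Rightarrow> (('x \<Rightarrow> complex) \<Rightarrow> ('x \<Rightarrow> complex) \<Rightarrow> complex) \<Rightarrow> 'x \<Rightarrow> ('x \<Rightarrow> complex) \<Rightarrow> bool"
  where
  "represents_evaluation H ip x k \<longleftrightarrow> k \<in> H \<and> (\<forall>F\<in>H. F x = ip F k)"

definition rkhs ::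
  "('x \<Rightarrow> complex) set \<Rightarrow> (('x \<Rightarrow> complex) \<Rightarrow> ('x \<Rightarrow> complex) \<Rightarrow> complex) \<Rightarrow> bool" where
  "rkhs H ip \<longleftrightarrow> hilbert_function_space H ip \<and> (\<forall>x. \<exists>k. represents_evaluation H ip x k)"

definition point_kernel ::
  "('x \<Rightarrow> complex) set \<Rightarrow> (('x \<Rightarrow> complex) \<Rightarrow> ('x \<Rightarrow> complex) \<Rightarrow> complex) \<Rightarrow> 'x \<Rightarrow> 'x \<Rightarrow> complex" where
  "point_kernel H ip x = (THE k. represents_evaluation H ip x k)"

lemma represents_evaluation_unique:
  assumes "rkhs H ip" "represents_evaluation H ip x k" "represents_evaluation H ip x l"
  shows "k = l"
proof
  fix y
  obtain e where e: "e \<in> H" "\<And>F. F \<in> H \<Longrightarrow> F y = ip F e"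
  proof -
    have "\<exists>k. represents_evaluation H ip y k"
      using assms(1)[unfolded rkhs_def] by (rule conjunct2[THEN spec])
    then show thesis using that by (auto simp only: represents_evaluation_def)
  qed
  have herm: "\<forall>F\<in>H. \<forall>G\<in>H. ip G F = cnj (ip F G)"
    using assms(1) unfolding rkhs_def hilbert_function_space_def inner_product_on_def
    by (elim conjE)
  have k: "k \<in> H" "e x = ip e k" and l: "l \<in> H" "e x = ip e l"
    using assms(2,3) e(1) unfolding represents_evaluation_def by simp_all
  have "k y = cnj (e x)"
    using e(2)[OF k(1)] herm[rule_format, OF e(1) k(1)] k(2) by simp
  moreover have "l y = cnj (e x)"
    using e(2)[OF l(1)] herm[rule_format, OF e(1) l(1)] l(2) by simp
  ultimately show "k y = l y" by simp
qed

lemma point_kernel_eqI: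
  assumes "rkhs H ip" "represents_evaluation H ip x k"
  shows "point_kernel H ip x = k"
  unfolding point_kernel_def
  by (rule the_equality[where P = "represents_evaluation H ip x", OF assms(2)])
    (rule represents_evaluation_unique[OF assms(1) _ assms(2)])

definition reproducing_kernel ::
  "('x \<Rightarrow> complex) set \<Rightarrow> (('x \<Rightarrow> complex) \<Rightarrow> ('x \<Rightarrow> complex) \<Rightarrow> complex) \<Rightarrow> 'x \<Rightarrow> 'x \<Rightarrow> complex" where
  "reproducing_kernel H ip x y = ip (point_kernel H ip y) (point_kernel H ip x)"

text \<open>The square matrix \<open>A\<close> has rows and columns indexed by the finite set \<open>S\<close>; being Hermitian
  follows from the quadratic form being real.\<close>

definition strictly_positive_definite_on :: "'x set \<Rightarrow> ('x \<Rightarrow> 'x \<Rightarrow> complex) \<Rightarrow> bool" where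
  "strictly_positive_definite_on S A \<longleftrightarrow>
     (\<forall>c :: 'x \<Rightarrow> complex. (\<exists>x\<in>S. c x \<noteq> 0) \<longrightarrow>
        (\<Sum>x\<in>S. \<Sum>y\<in>S. cnj (c x) * A x y * c y) \<in> \<real> \<and>
        0 < Re (\<Sum>x\<in>S. \<Sum>y\<in>S. cnj (c x) * A x y * c y))"

definition fully_interpolating ::
  "('x \<Rightarrow> complex) set \<Rightarrow> (('x \<Rightarrow> complex) \<Rightarrow> ('x \<Rightarrow> complex) \<Rightarrow> complex) \<Rightarrow> bool" where
  "fully_interpolating H ip \<longleftrightarrow>
     rkhs H ip \<and>
     (\<forall>S. finite S \<longrightarrow> strictly_positive_definite_on S (reproducing_kernel H ip))"

end

theory Submission
  imports Defs "HOL-Probability.Characteristic_Functions"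
begin

text \<open>
  Write \<open>\<pi>(x, \<omega>) g = M\<^sub>\<omega> T\<^sub>x g\<close>.  The equivalence holds separately for every window \<open>g\<close> of norm one
  (\<open>fully_interpolating_gabor_iff\<close>).  The point kernel of the Gabor space at \<open>p\<close> is \<open>V\<^sub>g(\<pi>(p) g)\<close>, and
  \<open>V\<^sub>g\<close> is isometric, so the reproducing kernel is \<open>K(p, q) = \<langle>\<pi>(q) g, \<pi>(p) g\<rangle>\<close>
  (\<open>reproducing_kernel_gabor\<close>).  Its restriction to a finite set \<open>S\<close> is a Gram matrix, with quadratic form
  \<open>c \<mapsto> \<parallel>\<Sum>\<^sub>p c\<^sub>p \<pi>(p) g\<parallel>\<^sup>2\<close>; this is strictly positive exactly if no nontrivial combination of the
  \<open>\<pi>(p) g\<close> vanishes almost everywhere (\<open>strictly_positive_definite_Gram_iff\<close>).  A general non-zero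
  window is reduced to a unit window by scaling.

  Full interpolation includes the claim that the Gabor space is a reproducing kernel Hilbert space, and
  most of the work goes into this.  Two facts are needed: Moyal's identity
  \<open>\<langle>V\<^sub>g f, V\<^sub>g h\<rangle> = \<parallel>g\<parallel>\<^sup>2 \<langle>f, h\<rangle>\<close> (\<open>L2_inner_stft\<close>), which turns evaluation \<open>V\<^sub>g f(p) = \<langle>f, \<pi>(p) g\<rangle>\<close> into an
  inner product of the Gabor space, and the completeness of \<open>L\<^sup>2\<close> (\<open>L2_complete\<close>), which the isometry
  transports to the Gabor space.

  By polarization it suffices to prove Moyal's identity for norms.  For fixed \<open>x\<close> the function
  \<open>V\<^sub>g f(x, \<cdot>)\<close> is the Fourier transform of \<open>h(t) = f(t) cnj (g(t - x))\<close>, which is integrable for all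
  \<open>x\<close> and square integrable for almost all \<open>x\<close>; so Tonelli's theorem reduces the identity to Plancherel's
  theorem on \<open>L\<^sup>1 \<inter> L\<^sup>2\<close> (\<open>plancherel\<close>).  That theorem is proved by inserting a Gaussian weight: with
  \<open>\<gamma>(v) = exp(-\<pi> |v|\<^sup>2)\<close>, Fubini's theorem gives
  \<open>\<integral> |h^(w)|\<^sup>2 \<gamma>(\<epsilon> w) dw = \<integral> \<gamma>(v) Re A(\<epsilon> v) dv\<close>, where \<open>A(u) = \<integral> h(t) cnj (h(t + u)) dt\<close>.  As
  \<open>\<epsilon>\<close> decreases to zero, the left side increases to \<open>\<integral> |h^|\<^sup>2\<close>, and the right side tends to
  \<open>A(0) = \<integral> |h|\<^sup>2\<close> because \<open>A\<close> is bounded and continuous at \<open>0\<close>.  The continuity is that of translation in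
  \<open>L\<^sup>2\<close> (\<open>L2_translation_continuous\<close>), which is deduced from that in \<open>L\<^sup>1\<close>.
\<close>


section \<open>Square-integrable functions\<close>

lemma L2_measurable [measurable_dest]: "f \<in> L2 \<Longrightarrow> f \<in> borel_measurable borel"
  by (simp add: L2_def)

lemma L2_integrable_norm_square: "f \<in> L2 \<Longrightarrow> integrable lborel (\<lambda>t. (cmod (f t))\<^sup>2)"
  by (simp add: L2_def)

lemma L2_iff_nn_integral_finite:
  "f \<in> L2 \<longleftrightarrow> f \<in> borel_measurable borel \<and> (\<integral>\<^sup>+t. ennreal ((cmod (f t))\<^sup>2) \<partial>lborel) < \<infinity>"
  by (auto simp: L2_def integrable_iff_bounded)

lemma integrable_mult_of_squares:
  fixes f h :: "'a \<Rightarrow> 'b::{real_normed_algebra, second_countable_topology, banach}"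
  assumes [measurable]: "f \<in> borel_measurable M" "h \<in> borel_measurable M"
    and "integrable M (\<lambda>t. (norm (f t))\<^sup>2)" "integrable M (\<lambda>t. (norm (h t))\<^sup>2)"
  shows "integrable M (\<lambda>t. f t * h t)"
proof (rule Bochner_Integration.integrable_bound)
  show "integrable M (\<lambda>t. (norm (f t))\<^sup>2 + (norm (h t))\<^sup>2)"
    using assms by simp
  show "AE t in M. norm (f t * h t) \<le> norm ((norm (f t))\<^sup>2 + (norm (h t))\<^sup>2)"
  proof (rule AE_I2)
    fix t
    have "2 * (norm (f t) * norm (h t)) \<le> (norm (f t))\<^sup>2 + (norm (h t))\<^sup>2"
      using sum_squares_bound[of "norm (f t)" "norm (h t)"] by (simp add: algebra_simps)
    moreover have "norm (f t * h t) \<le> norm (f t) * norm (h t)"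
      by (rule norm_mult_ineq)
    moreover have "0 \<le> norm (f t) * norm (h t)" by simp
    ultimately show "norm (f t * h t) \<le> norm ((norm (f t))\<^sup>2 + (norm (h t))\<^sup>2)"
      by (simp del: mult_nonneg_nonneg)
  qed
qed measurable

lemma borel_measurable_cnj [measurable (raw)]:
  "f \<in> borel_measurable M \<Longrightarrow> (\<lambda>x. cnj (f x)) \<in> borel_measurable M"
  by (rule measurable_compose[OF _ borel_measurable_continuous_onI]) (auto intro: continuous_intros)

lemma L2_cnj: "f \<in> L2 \<Longrightarrow> (\<lambda>t. cnj (f t)) \<in> L2"
  unfolding L2_def by auto

lemma L2_integrable_mult:
  assumes "f \<in> L2" "h \<in> L2"
  shows "integrable lborel (\<lambda>t. f t * h t)"
  using assms by (intro integrable_mult_of_squares) (auto simp: L2_def)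

lemma L2_integrable_inner:
  assumes "f \<in> L2" "h \<in> L2"
  shows "integrable lborel (\<lambda>t. f t * cnj (h t))"
  by (rule L2_integrable_mult[OF assms(1) L2_cnj[OF assms(2)]])

lemma L2_zero: "(\<lambda>t. 0) \<in> L2"
  by (simp add: L2_def)

lemma L2_scale: "f \<in> L2 \<Longrightarrow> (\<lambda>t. c * f t) \<in> L2"
  unfolding L2_def by (auto simp: norm_mult power_mult_distrib)

lemma cmod_add_squared_le: "(cmod (z + w))\<^sup>2 \<le> 2 * (cmod z)\<^sup>2 + 2 * (cmod w)\<^sup>2"
proof -
  have "(cmod (z + w))\<^sup>2 \<le> (cmod z + cmod w)\<^sup>2"
    by (intro power_mono norm_triangle_ineq) simp
  also have "\<dots> \<le> 2 * (cmod z)\<^sup>2 + 2 * (cmod w)\<^sup>2"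
    using sum_squares_bound[of "cmod z" "cmod w"] by (simp add: power2_sum)
  finally show ?thesis .
qed

lemma L2_add:
  assumes "f \<in> L2" "h \<in> L2"
  shows "(\<lambda>t. f t + h t) \<in> L2"
proof -
  note [measurable] = assms[THEN L2_measurable]
  have "integrable lborel (\<lambda>t. (cmod (f t + h t))\<^sup>2)"
  proof (rule Bochner_Integration.integrable_bound)
    show "integrable lborel (\<lambda>t. 2 * (cmod (f t))\<^sup>2 + 2 * (cmod (h t))\<^sup>2)"
      using assms[THEN L2_integrable_norm_square] by simp
    show "AE t in lborel. norm ((cmod (f t + h t))\<^sup>2) \<le> norm (2 * (cmod (f t))\<^sup>2 + 2 * (cmod (h t))\<^sup>2)"
      using cmod_add_squared_le by auto
  qed measurable
  then show ?thesis by (simp add: L2_def)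
qed

lemma L2_diff:
  assumes "f \<in> L2" "h \<in> L2"
  shows "(\<lambda>t. f t - h t) \<in> L2"
  using L2_add[OF assms(1) L2_scale[OF assms(2), of "-1"]] by simp

lemma L2_sum:
  assumes "\<And>i. i \<in> S \<Longrightarrow> \<phi> i \<in> L2"
  shows "(\<lambda>t. \<Sum>i\<in>S. c i * \<phi> i t) \<in> L2"
  using assms by (induction S rule: infinite_finite_induct) (auto intro!: L2_zero L2_add L2_scale)

lemma L2_inner_add_left:
  "\<lbrakk>f \<in> L2; h \<in> L2; k \<in> L2\<rbrakk> \<Longrightarrow> L2_inner (\<lambda>t. f t + h t) k = L2_inner f k + L2_inner h k"
  unfolding L2_inner_def by (simp add: distrib_right L2_integrable_inner)

lemma L2_inner_scale_left: "L2_inner (\<lambda>t. c * f t) k = c * L2_inner f k"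
  unfolding L2_inner_def by (simp add: mult.assoc)

lemma L2_inner_commute: "L2_inner h f = cnj (L2_inner f h)"
  unfolding L2_inner_def by (simp add: mult.commute flip: Bochner_Integration.integral_cnj)

lemma L2_inner_add_right:
  "\<lbrakk>f \<in> L2; h \<in> L2; k \<in> L2\<rbrakk> \<Longrightarrow> L2_inner k (\<lambda>t. f t + h t) = L2_inner k f + L2_inner k h"
  by (subst (1 2 3) L2_inner_commute) (simp add: L2_inner_add_left)

lemma L2_inner_scale_right: "L2_inner k (\<lambda>t. c * f t) = cnj c * L2_inner k f"
  by (subst (1 2) L2_inner_commute) (simp add: L2_inner_scale_left)

lemma L2_inner_sum_left:
  assumes "\<And>i. i \<in> S \<Longrightarrow> \<phi> i \<in> L2" "k \<in> L2"
  shows "L2_inner (\<lambda>t. \<Sum>i\<in>S. c i * \<phi> i t) k = (\<Sum>i\<in>S. c i * L2_inner (\<phi> i) k)"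
  unfolding L2_inner_def
  using assms by (simp add: sum_distrib_right Bochner_Integration.integral_sum L2_integrable_inner mult.assoc)

lemma L2_inner_sum_right:
  assumes "\<And>i. i \<in> S \<Longrightarrow> \<phi> i \<in> L2" "k \<in> L2"
  shows "L2_inner k (\<lambda>t. \<Sum>i\<in>S. c i * \<phi> i t) = (\<Sum>i\<in>S. cnj (c i) * L2_inner k (\<phi> i))"
proof -
  have "L2_inner k (\<lambda>t. \<Sum>i\<in>S. c i * \<phi> i t) = cnj (\<Sum>i\<in>S. c i * L2_inner (\<phi> i) k)"
    by (subst L2_inner_commute) (simp only: L2_inner_sum_left[OF assms])
  also have "\<dots> = (\<Sum>i\<in>S. cnj (c i) * cnj (L2_inner (\<phi> i) k))"
    by simp
  finally show ?thesis
    by (simp only: L2_inner_commute[of k])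
qed

lemma L2_inner_self: "L2_inner f f = complex_of_real (LINT t|lborel. (cmod (f t))\<^sup>2)"
  unfolding L2_inner_def complex_norm_square[symmetric] by (simp flip: of_real_power)

lemma L2_inner_self_norm: "L2_inner f f = complex_of_real ((L2_norm f)\<^sup>2)"
  by (simp add: L2_inner_self L2_norm_def)

lemma L2_inner_self_eq_0_iff:
  assumes "f \<in> L2"
  shows "L2_inner f f = 0 \<longleftrightarrow> (AE t in lborel. f t = 0)"
  using integral_nonneg_eq_0_iff_AE[OF L2_integrable_norm_square[OF assms]]
  by (simp add: L2_inner_self)

text \<open>A linear map that preserves norms therefore preserves inner products; this is how Moyal's identity
  passes from norms to inner products.\<close>
lemma L2_inner_polarization:
  assumes "f \<in> L2" "h \<in> L2"
  shows "4 * L2_inner f h = (\<Sum>c\<in>{1, -1, \<i>, -\<i>}.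
      c * complex_of_real ((L2_norm (\<lambda>t. f t + c * h t))\<^sup>2))"
proof -
  have "L2_inner (\<lambda>t. f t + c * h t) (\<lambda>t. f t + c * h t)
      = L2_inner f f + cnj c * L2_inner f h + c * L2_inner h f + c * cnj c * L2_inner h h" for c
    using assms by (simp add: L2_inner_add_left L2_inner_add_right L2_scale L2_add L2_inner_scale_left
        L2_inner_scale_right algebra_simps)
  then have expand: "complex_of_real ((L2_norm (\<lambda>t. f t + c * h t))\<^sup>2)
      = L2_inner f f + cnj c * L2_inner f h + c * L2_inner h f + c * cnj c * L2_inner h h" for c
    by (simp only: L2_inner_self_norm)
  have ii: "\<i> * (\<i> * z) = - z" for z
    by (simp add: mult.assoc[symmetric])
  show ?thesis
    unfolding expand by (simp add: complex_eq_iff algebra_simps ii)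
qed

lemma L2_norm_nonneg: "0 \<le> L2_norm f"
  by (simp add: L2_norm_def)

lemma nn_integral_L2_norm:
  assumes "f \<in> L2"
  shows "(\<integral>\<^sup>+t. ennreal ((cmod (f t))\<^sup>2) \<partial>lborel) = ennreal ((L2_norm f)\<^sup>2)"
  using nn_integral_eq_integral[OF L2_integrable_norm_square[OF assms]] by (simp add: L2_norm_def)

lemma L2_norm_eq_0_iff:
  assumes "f \<in> L2"
  shows "L2_norm f = 0 \<longleftrightarrow> (AE t in lborel. f t = 0)"
  using L2_inner_self_eq_0_iff[OF assms] by (simp add: L2_inner_self_norm)

lemma L2_norm_scale: "L2_norm (\<lambda>t. c * f t) = cmod c * L2_norm f"
  by (simp add: L2_norm_def norm_mult power_mult_distrib real_sqrt_mult)


section \<open>Affine changes of variables\<close>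

text \<open>The slope \<open>c\<close> may be negative: \<open>c = -1\<close> is the reflection that turns \<open>x \<mapsto> t - x\<close> into the identity in
  the proof of Moyal's identity.\<close>
lemma lborel_nn_integral_affine:
  fixes f :: "'a::euclidean_space \<Rightarrow> ennreal"
  assumes [measurable]: "f \<in> borel_measurable borel" and "c \<noteq> 0"
  shows "(\<integral>\<^sup>+x. f x \<partial>lborel) = ennreal (\<bar>c\<bar> ^ DIM('a)) * (\<integral>\<^sup>+x. f (a + c *\<^sub>R x) \<partial>lborel)"
  by (subst lborel_affine[OF \<open>c \<noteq> 0\<close>, of a])
    (simp add: nn_integral_density nn_integral_distr nn_integral_cmult)

lemma lborel_integral_affine:
  fixes f :: "'a::euclidean_space \<Rightarrow> 'b::{banach, second_countable_topology}"
  assumes [measurable]: "f \<in> borel_measurable borel" and "c \<noteq> 0"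
  shows "(LINT x|lborel. f x) = \<bar>c\<bar> ^ DIM('a) *\<^sub>R (LINT x|lborel. f (a + c *\<^sub>R x))"
  by (subst lborel_affine[OF \<open>c \<noteq> 0\<close>, of a])
    (simp add: integral_density integral_distr)

lemma lborel_integral_translate:
  fixes f :: "'a::euclidean_space \<Rightarrow> 'b::{banach, second_countable_topology}"
  assumes "f \<in> borel_measurable borel"
  shows "(LINT x|lborel. f (x + a)) = (LINT x|lborel. f x)"
  using lborel_integral_affine[OF assms, of 1 a] by (simp add: add.commute)

lemma lborel_nn_integral_translate:
  fixes f :: "'a::euclidean_space \<Rightarrow> ennreal"
  assumes "f \<in> borel_measurable borel"
  shows "(\<integral>\<^sup>+x. f (x + a) \<partial>lborel) = (\<integral>\<^sup>+x. f x \<partial>lborel)"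
  using lborel_nn_integral_affine[OF assms, of 1 a] by (simp add: add.commute)

lemma lborel_integrable_translate:
  fixes f :: "'a::euclidean_space \<Rightarrow> 'b::{banach, second_countable_topology}"
  assumes "integrable lborel f"
  shows "integrable lborel (\<lambda>x. f (x + a))"
proof -
  have [measurable]: "f \<in> borel_measurable borel"
    using assms by (auto dest: borel_measurable_integrable)
  show ?thesis
    using assms lborel_nn_integral_translate[of "\<lambda>x. ennreal (norm (f x))" a]
    by (simp add: integrable_iff_bounded)
qed


section \<open>Continuity of translation\<close>

text \<open>Continuity at \<open>0\<close> of the translation action on the orbit of \<open>f\<close>, expressed by sequences because the
  proofs rest on dominated convergence.\<close>
definition L1_translation_continuous ::
  "('a::euclidean_space \<Rightarrow> 'b::{banach, second_countable_topology}) \<Rightarrow> bool" where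
  "L1_translation_continuous f \<longleftrightarrow>
     (\<forall>u. u \<longlonglongrightarrow> 0 \<longrightarrow> (\<lambda>k. LINT t|lborel. norm (f (t + u k) - f t)) \<longlonglongrightarrow> 0)"

text \<open>Translations preserve the \<open>L\<^sup>1\<close> norm, so a limit of functions with this property inherits it by a
  three-epsilon argument.\<close>
lemma L1_translation_continuous_closed:
  fixes f :: "'a::euclidean_space \<Rightarrow> 'b::{banach, second_countable_topology}"
  assumes f: "integrable lborel f"
    and approx: "\<And>e. e > 0 \<Longrightarrow> \<exists>g. integrable lborel g \<and> L1_translation_continuous g \<and>
                    (LINT t|lborel. norm (f t - g t)) < e"
  shows "L1_translation_continuous f"
  unfolding L1_translation_continuous_def
proof (intro allI impI LIMSEQ_I)
  fix u :: "nat \<Rightarrow> 'a" and r :: real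
  assume u: "u \<longlonglongrightarrow> 0" and "r > 0"
  then obtain g where g: "integrable lborel g" "L1_translation_continuous g"
    and fg: "(LINT t|lborel. norm (f t - g t)) < r / 3"
    using approx[of "r / 3"] by auto
  have "(\<lambda>k. LINT t|lborel. norm (g (t + u k) - g t)) \<longlonglongrightarrow> 0"
    using g(2) u by (auto simp: L1_translation_continuous_def)
  from LIMSEQ_D[OF this, of "r / 3"] \<open>r > 0\<close> obtain N where
    N: "\<And>k. k \<ge> N \<Longrightarrow> (LINT t|lborel. norm (g (t + u k) - g t)) < r / 3"
    by auto
  have int: "integrable lborel (\<lambda>t. norm (f t - g t))"
    using f g(1) by simp
  have "(LINT t|lborel. norm (f (t + u k) - f t)) < r" if "k \<ge> N" for k
  proof -
    note tr = lborel_integrable_translate[of _ "u k"]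
    have "(LINT t|lborel. norm (f (t + u k) - f t))
        \<le> (LINT t|lborel. norm (f (t + u k) - g (t + u k)) + norm (g (t + u k) - g t) + norm (f t - g t))"
    proof (intro integral_mono Bochner_Integration.integrable_add)
      show "norm (f (t + u k) - f t)
        \<le> norm (f (t + u k) - g (t + u k)) + norm (g (t + u k) - g t) + norm (f t - g t)" for t
        using norm_triangle_ineq4[of "f (t + u k) - g (t + u k) + (g (t + u k) - g t)" "f t - g t"]
          norm_triangle_ineq[of "f (t + u k) - g (t + u k)" "g (t + u k) - g t"]
        by (simp add: algebra_simps)
    qed (use f g(1) tr[OF f] tr[OF g(1)] in simp_all)
    also have "\<dots> = (LINT t|lborel. norm (f (t + u k) - g (t + u k)))
        + (LINT t|lborel. norm (g (t + u k) - g t)) + (LINT t|lborel. norm (f t - g t))"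
      using f g(1) tr[OF f] tr[OF g(1)] by simp
    also have "(LINT t|lborel. norm (f (t + u k) - g (t + u k))) = (LINT t|lborel. norm (f t - g t))"
      using lborel_integral_translate[of "\<lambda>t. norm (f t - g t)" "u k"] borel_measurable_integrable[OF int]
      by simp
    finally show ?thesis
      using fg N[OF that] by linarith
  qed
  then show "\<exists>no. \<forall>k\<ge>no. norm ((LINT t|lborel. norm (f (t + u k) - f t)) - 0) < r"
    by (auto intro!: exI[of _ N])
qed

text \<open>If \<open>t\<close> lies in the open set \<open>U\<close>, then so does \<open>t + u\<^sub>k\<close> for large \<open>k\<close>.  Nothing similar holds on the
  boundary of \<open>U\<close>, so the difference of the indicators need not tend to zero pointwise.  The integral
  of their product avoids the problem: its integrand vanishes outside \<open>U\<close>, and since both indicators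
  have the same integral it determines the \<open>L\<^sup>1\<close> distance.\<close>
lemma L1_translation_continuous_open:
  fixes U :: "'a::euclidean_space set" and c :: "'b::{banach, second_countable_topology}"
  assumes "open U" "emeasure lborel U < \<infinity>"
  shows "L1_translation_continuous (\<lambda>t. indicator U t *\<^sub>R c)"
  unfolding L1_translation_continuous_def
proof (intro allI impI)
  fix u :: "nat \<Rightarrow> 'a"
  assume u: "u \<longlonglongrightarrow> 0"
  let ?i = "indicator U :: 'a \<Rightarrow> real"
  have [measurable]: "U \<in> sets borel" using assms by simp
  have int: "integrable lborel ?i"
    using assms by simp
  have int2: "integrable lborel (\<lambda>t. ?i t * ?i (t + u k))" for k
    by (rule Bochner_Integration.integrable_bound[OF int]) (auto simp: indicator_def)
  have "(\<lambda>k. LINT t|lborel. ?i t * ?i (t + u k)) \<longlonglongrightarrow> (LINT t|lborel. ?i t)"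
  proof (rule integral_dominated_convergence[where w = ?i])
    show "AE t in lborel. (\<lambda>k. ?i t * ?i (t + u k)) \<longlonglongrightarrow> ?i t"
    proof (intro AE_I2)
      fix t
      show "(\<lambda>k. ?i t * ?i (t + u k)) \<longlonglongrightarrow> ?i t"
      proof (cases "t \<in> U")
        case True
        have "(\<lambda>k. t + u k) \<longlonglongrightarrow> t"
          using tendsto_add[OF tendsto_const u, of t] by simp
        then have "\<forall>\<^sub>F k in sequentially. t + u k \<in> U"
          using \<open>open U\<close> True by (rule topological_tendstoD)
        then have "\<forall>\<^sub>F k in sequentially. ?i t * ?i (t + u k) = ?i t"
          by eventually_elim (use True in auto)
        then show ?thesis by (rule tendsto_eventually)
      qed simp
    qed
  qed (auto simp: int indicator_def)
  then have lim: "(\<lambda>k. norm c * (2 * (LINT t|lborel. ?i t) - 2 * (LINT t|lborel. ?i t * ?i (t + u k)))) \<longlonglongrightarrow>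
      norm c * (2 * (LINT t|lborel. ?i t) - 2 * (LINT t|lborel. ?i t))"
    by (intro tendsto_intros)
  have "(LINT t|lborel. norm (?i (t + u k) *\<^sub>R c - ?i t *\<^sub>R c))
      = norm c * (2 * (LINT t|lborel. ?i t) - 2 * (LINT t|lborel. ?i t * ?i (t + u k)))" for k
  proof -
    have "(LINT t|lborel. norm (?i (t + u k) *\<^sub>R c - ?i t *\<^sub>R c))
        = (LINT t|lborel. norm c * (?i (t + u k) + ?i t - 2 * (?i t * ?i (t + u k))))"
      by (intro Bochner_Integration.integral_cong) (auto simp: indicator_def)
    also have "\<dots> = norm c * ((LINT t|lborel. ?i (t + u k)) + (LINT t|lborel. ?i t)
          - 2 * (LINT t|lborel. ?i t * ?i (t + u k)))"
      using int int2[of k] lborel_integrable_translate[OF int, of "u k"] by simp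
    finally show ?thesis
      using lborel_integral_translate[of ?i "u k"] by simp
  qed
  with lim show "(\<lambda>k. LINT t|lborel. norm (?i (t + u k) *\<^sub>R c - ?i t *\<^sub>R c)) \<longlonglongrightarrow> 0"
    by simp
qed

text \<open>Outer regularity of Lebesgue measure approximates the indicator of a set of finite measure by that of
  an open set; sums and dominated limits then give all integrable functions.\<close>
lemma integrable_imp_L1_translation_continuous:
  fixes f :: "'a::euclidean_space \<Rightarrow> 'b::{banach, second_countable_topology}"
  assumes "integrable lborel f"
  shows "L1_translation_continuous f"
  using assms
proof (induct rule: integrable_induct)
  case (base A c)
  then have [measurable]: "A \<in> sets borel" and finA: "emeasure lborel A < \<infinity>" by auto
  show ?case
  proof (rule L1_translation_continuous_closed)
    show "integrable lborel (\<lambda>x. indicator A x *\<^sub>R c)"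
      using base by simp
    fix e :: real
    assume "e > 0"
    \<comment> \<open>The summand \<open>1\<close> covers \<open>c = 0\<close>.\<close>
    define d where "d = e / (norm c + 1)"
    have "d > 0" using \<open>e > 0\<close> by (simp add: d_def add_nonneg_pos)
    obtain U where U: "open U" "A \<subseteq> U" "emeasure lborel (U - A) < d"
      using outer_regular_lborel[OF \<open>A \<in> sets borel\<close> \<open>d > 0\<close>] .
    have [measurable]: "U \<in> sets borel" using U by simp
    have finUA: "emeasure lborel (U - A) < \<infinity>"
      using U(3) by (rule order_less_trans) simp
    have "emeasure lborel U \<le> emeasure lborel (A \<union> (U - A))"
      using U by (intro emeasure_mono) auto
    also have "\<dots> \<le> emeasure lborel A + emeasure lborel (U - A)"
      by (rule emeasure_subadditive) simp_all
    finally have finU: "emeasure lborel U < \<infinity>"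
      using finA finUA by (auto simp: order_le_less_trans)
    have "(LINT t|lborel. norm (indicator A t *\<^sub>R c - indicator U t *\<^sub>R c))
        = (LINT t|lborel. norm c * indicator (U - A) t)"
      by (intro Bochner_Integration.integral_cong) (use U in \<open>auto simp: indicator_def\<close>)
    also have "\<dots> = norm c * measure lborel (U - A)"
      using finUA by simp
    also have "\<dots> \<le> norm c * d"
      using U(3) finUA \<open>d > 0\<close>
      by (intro mult_left_mono) (auto simp: emeasure_eq_ennreal_measure ennreal_less_iff)
    also have "\<dots> < (norm c + 1) * d"
      using \<open>d > 0\<close> by simp
    also have "\<dots> = e"
    proof -
      have "norm c + 1 \<noteq> 0" using norm_ge_zero[of c] by linarith
      then show ?thesis by (simp add: d_def)
    qed
    finally have "(LINT t|lborel. norm (indicator A t *\<^sub>R c - indicator U t *\<^sub>R c)) < e" .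
    then show "\<exists>g. integrable lborel g \<and> L1_translation_continuous g \<and>
        (LINT t|lborel. norm (indicator A t *\<^sub>R c - g t)) < e"
      using L1_translation_continuous_open[OF U(1) finU] finU
      by (intro exI[of _ "\<lambda>t. indicator U t *\<^sub>R c"]) simp
  qed
next
  case (add f g)
  show ?case
    unfolding L1_translation_continuous_def
  proof (intro allI impI)
    fix u :: "nat \<Rightarrow> 'a"
    assume u: "u \<longlonglongrightarrow> 0"
    note tr = lborel_integrable_translate[OF add(1)] lborel_integrable_translate[OF add(3)]
    have lim: "(\<lambda>k. (LINT t|lborel. norm (f (t + u k) - f t)) + (LINT t|lborel. norm (g (t + u k) - g t)))
        \<longlonglongrightarrow> 0 + 0"
      using add u by (intro tendsto_add) (auto simp: L1_translation_continuous_def)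
    have le: "(LINT t|lborel. norm (f (t + u k) + g (t + u k) - (f t + g t)))
        \<le> (LINT t|lborel. norm (f (t + u k) - f t)) + (LINT t|lborel. norm (g (t + u k) - g t))" for k
    proof -
      have "(LINT t|lborel. norm (f (t + u k) + g (t + u k) - (f t + g t)))
          \<le> (LINT t|lborel. norm (f (t + u k) - f t) + norm (g (t + u k) - g t))"
        using add(1,3) tr[of "u k"] norm_diff_triangle_ineq
        by (intro integral_mono) auto
      then show ?thesis
        using add(1,3) tr[of "u k"] by simp
    qed
    show "(\<lambda>k. LINT t|lborel. norm (f (t + u k) + g (t + u k) - (f t + g t))) \<longlonglongrightarrow> 0"
    proof (rule Lim_null_comparison[OF _ lim[simplified]], intro always_eventually allI)
      fix k
      show "norm (LINT t|lborel. norm (f (t + u k) + g (t + u k) - (f t + g t)))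
          \<le> (LINT t|lborel. norm (f (t + u k) - f t)) + (LINT t|lborel. norm (g (t + u k) - g t))"
        using le[of k] by (simp only: real_norm_def abs_of_nonneg[OF Bochner_Integration.integral_nonneg] norm_ge_zero)
    qed
  qed
next
  case (lim f s)
  have [measurable]: "f \<in> borel_measurable borel" "s i \<in> borel_measurable borel" for i
    using lim(1)[of i] lim(5) by (auto dest: borel_measurable_integrable)
  have "(\<lambda>i. LINT t|lborel. norm (f t - s i t)) \<longlonglongrightarrow> (LINT t|(lborel::'a measure). 0)"
  proof (rule integral_dominated_convergence[where w = "\<lambda>t. 3 * norm (f t)"])
    show "AE t in lborel. (\<lambda>i. norm (f t - s i t)) \<longlonglongrightarrow> 0"
    proof (intro AE_I2)
      fix t
      have "(\<lambda>i. f t - s i t) \<longlonglongrightarrow> f t - f t"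
        using lim(3)[of t] by (intro tendsto_intros) simp
      then show "(\<lambda>i. norm (f t - s i t)) \<longlonglongrightarrow> 0"
        by (intro tendsto_norm_zero) simp
    qed
    show "AE t in lborel. norm (norm (f t - s i t)) \<le> 3 * norm (f t)" for i
    proof (intro AE_I2)
      fix t
      have "norm (f t - s i t) \<le> norm (f t) + norm (s i t)" by (rule norm_triangle_ineq4)
      also have "\<dots> \<le> 3 * norm (f t)" using lim(4)[of t i] by simp
      finally show "norm (norm (f t - s i t)) \<le> 3 * norm (f t)" by simp
    qed
  qed (use lim in auto)
  then have conv: "(\<lambda>i. LINT t|lborel. norm (f t - s i t)) \<longlonglongrightarrow> 0" by simp
  show ?case
  proof (rule L1_translation_continuous_closed[OF lim(5)])
    fix e :: real
    assume "e > 0"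
    then obtain i where "(LINT t|lborel. norm (f t - s i t)) < e"
      using LIMSEQ_D[OF conv \<open>e > 0\<close>] by auto
    then show "\<exists>g. integrable lborel g \<and> L1_translation_continuous g \<and> (LINT t|lborel. norm (f t - g t)) < e"
      using lim(1,2) by blast
  qed
qed

text \<open>The map \<open>z \<mapsto> |z| z\<close> carries \<open>L\<^sup>2\<close> into \<open>L\<^sup>1\<close>, and this inequality bounds squared \<open>L\<^sup>2\<close> distances by
  \<open>L\<^sup>1\<close> distances of the images.  It follows from the strong monotonicity
  \<open>(|z| z - |w| w) \<bullet> (z - w) \<ge> (|z| + |w|) |z - w|\<^sup>2 / 2\<close>, in which the two sides differ by
  \<open>(|z| + |w|) (|z| - |w|)\<^sup>2 / 2\<close>.\<close>
lemma norm_diff_squared_le: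
  fixes z w :: "'a::real_inner"
  shows "(norm (z - w))\<^sup>2 \<le> 2 * norm (norm z *\<^sub>R z - norm w *\<^sub>R w)"
proof (cases "z = w")
  case False
  define a b where "a = norm z" and "b = norm w"
  have sq: "(norm (z - w))\<^sup>2 = a\<^sup>2 + b\<^sup>2 - 2 * (z \<bullet> w)"
    by (simp add: a_def b_def power2_norm_eq_inner inner_diff inner_commute)
  have "(a + b) * (norm (z - w))\<^sup>2 \<le> 2 * (a ^ 3 + b ^ 3 - (a + b) * (z \<bullet> w))"
  proof -
    have "0 \<le> (a + b) * (a - b)\<^sup>2" by (simp add: a_def b_def)
    also have "\<dots> = 2 * (a ^ 3 + b ^ 3 - (a + b) * (z \<bullet> w)) - (a + b) * (norm (z - w))\<^sup>2"
      unfolding sq by (simp add: algebra_simps power2_eq_square power3_eq_cube)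
    finally show ?thesis by simp
  qed
  also have "a ^ 3 + b ^ 3 - (a + b) * (z \<bullet> w) = (a *\<^sub>R z - b *\<^sub>R w) \<bullet> (z - w)"
    by (simp add: a_def b_def inner_diff inner_commute algebra_simps power3_eq_cube
        power2_norm_eq_inner[unfolded power2_eq_square, symmetric])
  also have "\<dots> \<le> norm (a *\<^sub>R z - b *\<^sub>R w) * norm (z - w)"
    by (rule norm_cauchy_schwarz)
  finally have *: "norm (z - w) * ((a + b) * norm (z - w)) \<le> norm (z - w) * (2 * norm (a *\<^sub>R z - b *\<^sub>R w))"
    by (simp add: power2_eq_square mult_ac)
  have "norm (z - w) \<le> a + b"
    unfolding a_def b_def by (rule norm_triangle_ineq4)
  then have "(norm (z - w))\<^sup>2 \<le> (a + b) * norm (z - w)"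
    by (simp add: power2_eq_square mult_right_mono)
  also have "\<dots> \<le> 2 * norm (a *\<^sub>R z - b *\<^sub>R w)"
    using * False by simp
  finally show ?thesis by (simp add: a_def b_def)
qed simp

lemma L2_translate:
  assumes "h \<in> L2"
  shows "(\<lambda>t. h (t + a)) \<in> L2"
proof -
  note [measurable] = L2_measurable[OF assms]
  have "(\<lambda>t. h (t + a)) \<in> borel_measurable lborel" by simp
  then show ?thesis
    using lborel_integrable_translate[OF L2_integrable_norm_square[OF assms]] by (simp add: L2_def)
qed

text \<open>Translation commutes with \<open>h \<mapsto> |h| h\<close>, so the claim reduces to the integrable function \<open>|h| h\<close>.\<close>
lemma L2_translation_continuous:
  assumes h: "h \<in> L2" and u: "u \<longlonglongrightarrow> 0"
  shows "(\<lambda>k. LINT t|lborel. (cmod (h (t + u k) - h t))\<^sup>2) \<longlonglongrightarrow> 0"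
proof -
  note [measurable] = L2_measurable[OF h]
  let ?q = "\<lambda>t. cmod (h t) *\<^sub>R h t"
  have int: "integrable lborel ?q"
  proof (rule Bochner_Integration.integrable_bound[OF L2_integrable_norm_square[OF h]])
    show "AE t in lborel. norm (?q t) \<le> norm ((cmod (h t))\<^sup>2)"
      by (simp add: power2_eq_square)
  qed simp
  have "(\<lambda>k. 2 * (LINT t|lborel. norm (?q (t + u k) - ?q t))) \<longlonglongrightarrow> 2 * 0"
    using integrable_imp_L1_translation_continuous[OF int] u
    by (intro tendsto_intros) (auto simp: L1_translation_continuous_def)
  then have lim: "(\<lambda>k. 2 * (LINT t|lborel. norm (?q (t + u k) - ?q t))) \<longlonglongrightarrow> 0" by simp
  have le: "(LINT t|lborel. (cmod (h (t + u k) - h t))\<^sup>2)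
      \<le> 2 * (LINT t|lborel. norm (?q (t + u k) - ?q t))" for k
  proof -
    have "(LINT t|lborel. (cmod (h (t + u k) - h t))\<^sup>2)
        \<le> (LINT t|lborel. 2 * norm (?q (t + u k) - ?q t))"
    proof (rule integral_mono)
      show "integrable lborel (\<lambda>t. (cmod (h (t + u k) - h t))\<^sup>2)"
        using L2_integrable_norm_square[OF L2_diff[OF L2_translate[OF h] h]] .
      show "integrable lborel (\<lambda>t. 2 * norm (?q (t + u k) - ?q t))"
        using int lborel_integrable_translate[OF int, of "u k"] by simp
    qed (rule norm_diff_squared_le)
    then show ?thesis by simp
  qed
  show ?thesis
  proof (rule Lim_null_comparison[OF _ lim], intro always_eventually allI)
    fix k
    show "norm (LINT t|lborel. (cmod (h (t + u k) - h t))\<^sup>2) \<le> 2 * (LINT t|lborel. norm (?q (t + u k) - ?q t))"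
      using le[of k] by (simp only: real_norm_def abs_of_nonneg[OF Bochner_Integration.integral_nonneg] zero_le_power2)
  qed
qed


section \<open>Gaussians and their Fourier transforms\<close>

text \<open>The normalization \<open>r \<mapsto> exp(-2 \<pi> i r)\<close> of the character makes the Fourier transform below isometric
  without a constant factor.\<close>
definition character :: "real \<Rightarrow> complex" where
  "character r = exp (- 2 * complex_of_real pi * \<i> * complex_of_real r)"

lemma norm_character [simp]: "cmod (character r) = 1"
  by (simp add: character_def)

lemma character_add: "character (r + s) = character r * character s"
  by (simp add: character_def ring_distribs flip: exp_add)

lemma character_zero [simp]: "character 0 = 1"
  by (simp add: character_def)

lemma character_sum: "character (\<Sum>i\<in>S. r i) = (\<Prod>i\<in>S. character (r i))"
  by (induction S rule: infinite_finite_induct) (auto simp: character_add)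

lemma cnj_character: "cnj (character r) = character (- r)"
  by (simp add: character_def exp_cnj)

lemma borel_measurable_character [measurable]: "character \<in> borel_measurable borel"
  unfolding character_def by measurable

definition gaussian :: "'a::euclidean_space \<Rightarrow> real" where
  "gaussian v = exp (- (pi * (norm v)\<^sup>2))"

lemma gaussian_nonneg [simp]: "0 \<le> gaussian v"
  by (simp add: gaussian_def)

lemma borel_measurable_gaussian [measurable]: "gaussian \<in> borel_measurable borel"
  unfolding gaussian_def[abs_def] by measurable

text \<open>Lebesgue measure on a Euclidean space is the product of its coordinate measures, so integrals of
  products of functions of one coordinate each factorize.\<close>
lemma lborel_integral_prod_Basis:
  fixes f :: "'a::euclidean_space \<Rightarrow> real \<Rightarrow> complex"
  assumes int: "\<And>b. b \<in> Basis \<Longrightarrow> integrable lborel (f b)"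
  shows "integrable lborel (\<lambda>x::'a. \<Prod>b\<in>Basis. f b (x \<bullet> b))"
    and "(LINT x|lborel. (\<Prod>b\<in>Basis. f b (x \<bullet> b))) = (\<Prod>b\<in>(Basis::'a set). LINT x|lborel. f b x)"
proof -
  interpret product_sigma_finite "\<lambda>_::'a. lborel :: real measure" ..
  have [measurable]: "f b \<in> borel_measurable borel" if "b \<in> Basis" for b
    using int[OF that] by (auto dest: borel_measurable_integrable)
  have meas: "(\<lambda>x::'a. \<Prod>b\<in>Basis. f b (x \<bullet> b)) \<in> borel_measurable borel"
    by measurable
  have coord: "(\<Prod>b\<in>Basis. f b ((\<Sum>c\<in>Basis. x c *\<^sub>R c) \<bullet> b)) = (\<Prod>b\<in>Basis. f b (x b))" for x :: "'a \<Rightarrow> real"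
    by (intro prod.cong refl) simp
  show "integrable lborel (\<lambda>x::'a. \<Prod>b\<in>Basis. f b (x \<bullet> b))"
    unfolding lborel_eq[where 'a='a]
    by (subst integrable_distr_eq) (use meas in \<open>simp_all add: coord product_integrable_prod int\<close>)
  show "(LINT x|lborel. (\<Prod>b\<in>Basis. f b (x \<bullet> b))) = (\<Prod>b\<in>(Basis::'a set). LINT x|lborel. f b x)"
    unfolding lborel_eq[where 'a='a]
    by (subst integral_distr) (use meas in \<open>simp_all add: coord product_integral_prod int\<close>)
qed

text \<open>This is the characteristic function of the standard normal distribution after the substitution
  \<open>x = sqrt (2 \<pi>) e w\<close>.\<close>
lemma fourier_gaussian_real:
  fixes e u :: real
  assumes "e > 0"
  shows "integrable lborel (\<lambda>w::real. complex_of_real (exp (- (pi * (e * w)\<^sup>2))) * character (u * w))"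
    and "(LINT w|lborel. complex_of_real (exp (- (pi * (e * w)\<^sup>2))) * character (u * w))
      = complex_of_real (exp (- (pi * (u / e)\<^sup>2)) / e)"
proof -
  define c where "c = sqrt (2 * pi) * e"
  define t where "t = - (2 * pi * u) / c"
  have "c > 0" using assms by (simp add: c_def)
  let ?f = "\<lambda>x. complex_of_real (std_normal_density x) * iexp (t * x)"
  have int: "integrable lborel ?f"
  proof (rule Bochner_Integration.integrable_bound)
    show "integrable lborel std_normal_density" by simp
  qed (auto simp: norm_mult)
  have val: "(LINT x|lborel. ?f x) = complex_of_real (exp (- (t\<^sup>2) / 2))"
    using char_std_normal_distribution[THEN fun_cong, of t]
    by (simp add: char_def integral_density normal_density_nonneg scaleR_conv_of_real)
  have f: "?f (0 + c * w) = complex_of_real (1 / sqrt (2 * pi)) *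
      (complex_of_real (exp (- (pi * (e * w)\<^sup>2))) * character (u * w))" for w
  proof -
    have "t * (c * w) = - (2 * pi * (u * w))"
      using \<open>c > 0\<close> by (simp add: t_def)
    then have "iexp (t * (c * w)) = character (u * w)"
      by (simp add: character_def mult_ac)
    moreover have "std_normal_density (c * w) = 1 / sqrt (2 * pi) * exp (- (pi * (e * w)\<^sup>2))"
      by (simp add: normal_density_def c_def power_mult_distrib mult_ac)
    ultimately show ?thesis by (simp add: mult_ac)
  qed
  have "integrable lborel (\<lambda>w. ?f (0 + c * w))"
    by (rule lborel_integrable_real_affine[OF int]) (use \<open>c > 0\<close> in simp)
  then have "integrable lborel (\<lambda>w. complex_of_real (sqrt (2 * pi)) * ?f (0 + c * w))"
    by (rule integrable_mult_right)
  then show "integrable lborel (\<lambda>w::real. complex_of_real (exp (- (pi * (e * w)\<^sup>2))) * character (u * w))"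
    unfolding f by simp
  have "complex_of_real (exp (- (t\<^sup>2) / 2)) = \<bar>c\<bar> *\<^sub>R (LINT w|lborel. ?f (0 + c * w))"
    unfolding val[symmetric] by (rule lborel_integral_real_affine) (use \<open>c > 0\<close> in simp)
  also have "\<dots> = complex_of_real e *
      (LINT w|lborel. complex_of_real (exp (- (pi * (e * w)\<^sup>2))) * character (u * w))"
    unfolding f using \<open>c > 0\<close> by (simp add: scaleR_conv_of_real c_def)
  finally have *: "complex_of_real e *
      (LINT w|lborel. complex_of_real (exp (- (pi * (e * w)\<^sup>2))) * character (u * w))
      = complex_of_real (exp (- (t\<^sup>2) / 2))" ..
  have "t\<^sup>2 / 2 = pi * (u / e)\<^sup>2"
    using assms by (simp add: t_def c_def power_mult_distrib power_divide field_simps power2_eq_square)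
  with * assms show "(LINT w|lborel. complex_of_real (exp (- (pi * (e * w)\<^sup>2))) * character (u * w))
      = complex_of_real (exp (- (pi * (u / e)\<^sup>2)) / e)"
    by (simp add: field_simps)
qed

lemma fourier_gaussian:
  fixes u :: "'a::euclidean_space"
  assumes "e > 0"
  shows "integrable lborel (\<lambda>w::'a. complex_of_real (gaussian (e *\<^sub>R w)) * character (u \<bullet> w))"
    and "(LINT w|lborel. complex_of_real (gaussian (e *\<^sub>R w)) * character (u \<bullet> w))
      = complex_of_real (gaussian (u /\<^sub>R e) / e ^ DIM('a))"
proof -
  have dilate: "gaussian (e *\<^sub>R w) = exp (- (pi * (e * norm w)\<^sup>2))" for w :: 'a
    using assms by (simp add: gaussian_def)
  have contract: "gaussian (u /\<^sub>R e) = exp (- (pi * (norm u / e)\<^sup>2))"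
    using assms by (simp add: gaussian_def divide_inverse_commute)
  let ?g = "\<lambda>b w. complex_of_real (exp (- (pi * (e * w)\<^sup>2))) * character ((u \<bullet> b) * w)"
  have norm2: "(norm x)\<^sup>2 = (\<Sum>b\<in>Basis. (x \<bullet> b)\<^sup>2)" for x :: 'a
    by (subst power2_norm_eq_inner, subst euclidean_inner) (simp add: power2_eq_square)
  have split: "complex_of_real (exp (- (pi * (e * norm w)\<^sup>2))) * character (u \<bullet> w)
      = (\<Prod>b\<in>Basis. ?g b (w \<bullet> b))" for w
  proof -
    have "exp (- (pi * (e * norm w)\<^sup>2)) = (\<Prod>b\<in>Basis. exp (- (pi * (e * (w \<bullet> b))\<^sup>2)))"
      by (simp add: power_mult_distrib norm2 sum_distrib_left sum_negf flip: exp_sum)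
    moreover have "character (u \<bullet> w) = (\<Prod>b\<in>Basis. character ((u \<bullet> b) * (w \<bullet> b)))"
      by (subst euclidean_inner) (rule character_sum)
    ultimately show ?thesis by (simp add: prod.distrib)
  qed
  note 1 = lborel_integral_prod_Basis[of ?g, OF fourier_gaussian_real(1)[OF assms]]
  show "integrable lborel (\<lambda>w::'a. complex_of_real (gaussian (e *\<^sub>R w)) * character (u \<bullet> w))"
    unfolding dilate split by (rule 1)
  have "(LINT w|lborel. complex_of_real (exp (- (pi * (e * norm w)\<^sup>2))) * character (u \<bullet> w))
      = (\<Prod>b\<in>(Basis::'a set). complex_of_real (exp (- (pi * ((u \<bullet> b) / e)\<^sup>2)) / e))"
    unfolding split 1 fourier_gaussian_real(2)[OF assms] ..
  also have "\<dots> = complex_of_real (exp (- (pi * (norm u / e)\<^sup>2)) / e ^ DIM('a))"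
    by (simp add: prod_dividef power_divide norm2 sum_divide_distrib sum_distrib_left sum_negf
        flip: exp_sum of_real_prod of_real_power)
  finally show "(LINT w|lborel. complex_of_real (gaussian (e *\<^sub>R w)) * character (u \<bullet> w))
      = complex_of_real (gaussian (u /\<^sub>R e) / e ^ DIM('a))"
    unfolding dilate contract .
qed

lemma has_bochner_integral_gaussian:
  "has_bochner_integral lborel (gaussian :: 'a::euclidean_space \<Rightarrow> real) 1"
proof -
  have int: "integrable lborel (gaussian :: 'a \<Rightarrow> real)"
    using fourier_gaussian(1)[of 1 "0::'a"] by (simp add: complex_of_real_integrable_eq)
  moreover have "(LINT v|lborel. (gaussian :: 'a \<Rightarrow> real) v) = 1"
    using fourier_gaussian(2)[of 1 "0::'a"] by (simp add: gaussian_def flip: of_real_exp)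
  ultimately show ?thesis by (simp add: has_bochner_integral_iff)
qed

lemmas integrable_gaussian = has_bochner_integral_gaussian[THEN integrable.intros]
lemmas integral_gaussian = has_bochner_integral_gaussian[THEN has_bochner_integral_integral_eq]

lemma integrable_gaussian_scaled:
  assumes "e > 0"
  shows "integrable lborel (\<lambda>w::'a::euclidean_space. gaussian (e *\<^sub>R w))"
  using fourier_gaussian(1)[OF assms, of "0::'a"] by (simp add: complex_of_real_integrable_eq)


section \<open>The Fourier transform and Plancherel's theorem\<close>

definition fourier :: "('a::euclidean_space \<Rightarrow> complex) \<Rightarrow> 'a \<Rightarrow> complex" where
  "fourier h w = (LINT t|lborel. h t * character (t \<bullet> w))"

lemma integrable_mult_character:
  assumes "integrable lborel h"
  shows "integrable lborel (\<lambda>t::'a::euclidean_space. h t * character (t \<bullet> w))"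
proof -
  have [measurable]: "h \<in> borel_measurable borel"
    using assms by (auto dest: borel_measurable_integrable)
  show ?thesis
    by (rule Bochner_Integration.integrable_bound[OF assms]) (auto simp: norm_mult)
qed

lemma norm_fourier_le:
  assumes "integrable lborel h"
  shows "cmod (fourier h w) \<le> (LINT t|lborel. cmod (h t))"
  unfolding fourier_def
  using integral_norm_bound[of lborel "\<lambda>t. h t * character (t \<bullet> w)"] by (simp add: norm_mult)

lemma borel_measurable_fourier:
  fixes h :: "'a::euclidean_space \<Rightarrow> complex"
  assumes [measurable]: "h \<in> borel_measurable borel"
  shows "fourier h \<in> borel_measurable borel"
proof -
  have "(\<lambda>w::'a. LINT t|lborel. h t * character (t \<bullet> w)) \<in> borel_measurable lborel"
    by measurable
  then show ?thesis by (simp add: fourier_def[abs_def])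
qed

text \<open>Both sides are Fubini evaluations of the integral of \<open>h(t) character(t \<bullet> w) k(w)\<close>, which is absolutely
  convergent as \<open>h\<close> and \<open>k\<close> are integrable.\<close>
lemma fourier_multiplication:
  fixes h k :: "'a::euclidean_space \<Rightarrow> complex"
  assumes h: "integrable lborel h" and k: "integrable lborel k"
  shows "(LINT w|lborel. fourier h w * k w) = (LINT t|lborel. h t * fourier k t)"
proof -
  have [measurable]: "h \<in> borel_measurable borel" "k \<in> borel_measurable borel"
    using h k by (auto dest: borel_measurable_integrable)
  let ?F = "\<lambda>t w. h t * character (t \<bullet> w) * k w"
  have "integrable (lborel \<Otimes>\<^sub>M lborel) (case_prod ?F)"
  proof (rule lborel_pair.Fubini_integrable)
    show "integrable lborel (\<lambda>t. LINT w|lborel. norm (case_prod ?F (t, w)))"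
      using h by (simp add: norm_mult)
    show "AE t in lborel. integrable lborel (\<lambda>w. case_prod ?F (t, w))"
      using integrable_mult_character[OF k] by (intro AE_I2) (simp add: inner_commute mult_ac)
  qed measurable
  from lborel_pair.Fubini_integral[OF this]
  have "(LINT w|lborel. LINT t|lborel. ?F t w) = (LINT t|lborel. LINT w|lborel. ?F t w)" .
  moreover have "(LINT t|lborel. ?F t w) = fourier h w * k w" for w
    by (simp add: fourier_def)
  moreover have "(LINT w|lborel. ?F t w) = h t * fourier k t" for t
    unfolding fourier_def
    by (subst integral_mult_right_zero[symmetric]) (simp add: mult_ac inner_commute)
  ultimately show ?thesis by (simp only:)
qed

text \<open>Expanding the square and using translation invariance, the autocorrelation differs from its value at
  \<open>0\<close> by half the squared \<open>L\<^sup>2\<close> distance of \<open>h\<close> to its translate.  Hence translation continuity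
  suffices to evaluate its limit.\<close>
lemma Re_autocorrelation:
  assumes h: "h \<in> L2"
  shows "Re (LINT t|lborel. h t * cnj (h (t + u)))
    = (LINT t|lborel. (cmod (h t))\<^sup>2) - (LINT t|lborel. (cmod (h (t + u) - h t))\<^sup>2) / 2"
proof -
  note [measurable] = L2_measurable[OF h]
  note hu = L2_translate[OF h, of u]
  have "(LINT t|lborel. (cmod (h (t + u) - h t))\<^sup>2)
      = (LINT t|lborel. (cmod (h (t + u)))\<^sup>2 + (cmod (h t))\<^sup>2 - 2 * Re (h t * cnj (h (t + u))))"
    by (intro Bochner_Integration.integral_cong refl)
      (simp add: cmod_power2 power2_diff algebra_simps)
  also have "\<dots> = (LINT t|lborel. (cmod (h (t + u)))\<^sup>2) + (LINT t|lborel. (cmod (h t))\<^sup>2)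
      - 2 * Re (LINT t|lborel. h t * cnj (h (t + u)))"
    using L2_integrable_norm_square[OF h] L2_integrable_norm_square[OF hu] L2_integrable_inner[OF h hu]
    by (simp add: integral_Re del: times_complex.sel)
  also have "(LINT t|lborel. (cmod (h (t + u)))\<^sup>2) = (LINT t|lborel. (cmod (h t))\<^sup>2)"
    by (rule lborel_integral_translate) simp
  finally show ?thesis by (simp add: diff_divide_distrib)
qed

text \<open>The weight makes \<open>k = cnj h^ \<cdot> \<gamma>(e \<cdot>)\<close> integrable, so the multiplication formula moves the transform
  from \<open>h\<close> to \<open>k\<close>.  A second use of the formula computes \<open>k^\<close> as the convolution of \<open>cnj h\<close>
  with the transform of the weight, a Gaussian of width \<open>e\<close>.\<close>
lemma gaussian_weighted_plancherel:
  fixes h :: "'a::euclidean_space \<Rightarrow> complex"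
  assumes h1: "integrable lborel h" and h2: "h \<in> L2" and "e > 0"
  shows "integrable lborel (\<lambda>w. (cmod (fourier h w))\<^sup>2 * gaussian (e *\<^sub>R w))"
    and "(LINT w|lborel. (cmod (fourier h w))\<^sup>2 * gaussian (e *\<^sub>R w))
      = (LINT v|lborel. gaussian v * Re (LINT t|lborel. h t * cnj (h (t + e *\<^sub>R v))))"
proof -
  note [measurable] = L2_measurable[OF h2] borel_measurable_fourier[OF L2_measurable[OF h2]]
  define N where "N = (LINT t|lborel. (cmod (h t))\<^sup>2)"
  let ?g = "\<lambda>w::'a. complex_of_real (gaussian (e *\<^sub>R w))"
  define k where "k = (\<lambda>w. cnj (fourier h w) * ?g w)"
  have bound: "integrable lborel (\<lambda>w::'a. C * gaussian (e *\<^sub>R w))" for C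
    by (intro integrable_mult_right integrable_gaussian_scaled \<open>e > 0\<close>)
  note fb = norm_fourier_le[OF h1]
  have k: "integrable lborel k"
    by (rule Bochner_Integration.integrable_bound[OF bound[of "LINT t|lborel. cmod (h t)"]])
      (auto simp: k_def norm_mult abs_mult intro!: mult_right_mono order_trans[OF fb])
  show int: "integrable lborel (\<lambda>w. (cmod (fourier h w))\<^sup>2 * gaussian (e *\<^sub>R w))"
    by (rule Bochner_Integration.integrable_bound[OF bound[of "(LINT t|lborel. cmod (h t))\<^sup>2"]])
      (auto simp: abs_mult intro!: mult_right_mono power_mono fb)
  have k_hat: "fourier k t = (LINT v|lborel. complex_of_real (gaussian v) * cnj (h (t + e *\<^sub>R v)))" for t
  proof -
    \<comment> \<open>Up to conjugation, \<open>fourier k t\<close> is the integral of \<open>fourier h\<close> against the modulated weight \<open>?m\<close>.\<close>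
    let ?m = "\<lambda>w. ?g w * character (- (t \<bullet> w))"
    have m: "integrable lborel ?m"
      using fourier_gaussian(1)[OF \<open>e > 0\<close>, of "- t"] by simp
    have m_hat: "fourier ?m s = complex_of_real (gaussian ((s - t) /\<^sub>R e) / e ^ DIM('a))" for s
    proof -
      have "fourier ?m s = (LINT w|lborel. ?g w * character ((s - t) \<bullet> w))"
        unfolding fourier_def
        by (intro Bochner_Integration.integral_cong refl)
          (simp add: mult.assoc inner_diff_left inner_diff_right inner_commute flip: character_add)
      then show ?thesis
        unfolding fourier_gaussian(2)[OF \<open>e > 0\<close>] .
    qed
    have "fourier k t = cnj (LINT w|lborel. fourier h w * ?m w)"
      unfolding fourier_def[of k] Bochner_Integration.integral_cnj[symmetric]
      by (intro Bochner_Integration.integral_cong refl)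
        (simp add: k_def cnj_character inner_commute mult_ac)
    also have "(LINT w|lborel. fourier h w * ?m w) = (LINT s|lborel. h s * fourier ?m s)"
      by (rule fourier_multiplication[OF h1 m])
    \<comment> \<open>Substituting \<open>s = t + e v\<close> cancels the factor \<open>1 / e\<^sup>n\<close> and leaves a Gaussian independent of \<open>e\<close>.\<close>
    also have "\<dots> = e ^ DIM('a) *\<^sub>R (LINT v|lborel. h (t + e *\<^sub>R v) * fourier ?m (t + e *\<^sub>R v))"
      using lborel_integral_affine[of "\<lambda>s. h s * fourier ?m s" e t] \<open>e > 0\<close>
      unfolding m_hat by simp
    also have "\<dots> = (LINT v|lborel. complex_of_real (gaussian v) * h (t + e *\<^sub>R v))"
      unfolding m_hat using \<open>e > 0\<close>
      by (subst integral_scaleR_right[symmetric])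
        (auto intro!: Bochner_Integration.integral_cong simp: scaleR_conv_of_real)
    finally show ?thesis
      by (simp flip: Bochner_Integration.integral_cnj)
  qed
  let ?F = "\<lambda>v t. complex_of_real (gaussian v) * (h t * cnj (h (t + e *\<^sub>R v)))"
  have corr: "integrable lborel (\<lambda>t. h t * cnj (h (t + u)))" for u
    by (rule L2_integrable_inner[OF h2 L2_translate[OF h2]])
  have corr_le: "(LINT t|lborel. cmod (h t * cnj (h (t + u)))) \<le> N" for u
  proof -
    have "(LINT t|lborel. cmod (h t * cnj (h (t + u))))
        \<le> (LINT t|lborel. ((cmod (h t))\<^sup>2 + (cmod (h (t + u)))\<^sup>2) / 2)"
    proof (rule integral_mono)
      show "cmod (h t * cnj (h (t + u))) \<le> ((cmod (h t))\<^sup>2 + (cmod (h (t + u)))\<^sup>2) / 2" for t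
        using sum_squares_bound[of "cmod (h t)" "cmod (h (t + u))"] by (simp add: norm_mult)
    qed (use corr L2_integrable_norm_square[OF h2] L2_integrable_norm_square[OF L2_translate[OF h2]] in auto)
    also have "\<dots> = N"
      using L2_integrable_norm_square[OF h2] L2_integrable_norm_square[OF L2_translate[OF h2, of u]]
        lborel_integral_translate[of "\<lambda>t. (cmod (h t))\<^sup>2" u]
      by (simp add: N_def)
    finally show ?thesis .
  qed
  have "integrable (lborel \<Otimes>\<^sub>M lborel) (case_prod ?F)"
  proof (rule lborel_pair.Fubini_integrable)
    show "integrable lborel (\<lambda>v. LINT t|lborel. norm (case_prod ?F (v, t)))"
    proof (rule Bochner_Integration.integrable_bound)
      show "integrable lborel (\<lambda>v::'a. gaussian v * N)"
        by (intro integrable_mult_left integrable_gaussian)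
      show "AE v in lborel. norm (LINT t|lborel. norm (case_prod ?F (v, t))) \<le> norm (gaussian v * N)"
      proof (intro AE_I2)
        fix v :: 'a
        have "norm (LINT t|lborel. norm (case_prod ?F (v, t)))
            = gaussian v * (LINT t|lborel. cmod (h t * cnj (h (t + e *\<^sub>R v))))"
          by (simp add: norm_mult abs_mult)
        also have "\<dots> \<le> gaussian v * N"
          using corr_le by (intro mult_left_mono) auto
        finally show "norm (LINT t|lborel. norm (case_prod ?F (v, t))) \<le> norm (gaussian v * N)"
          by simp
      qed
    qed measurable
    show "AE v in lborel. integrable lborel (\<lambda>t. case_prod ?F (v, t))"
      using corr by simp
  qed measurable
  from lborel_pair.Fubini_integral[OF this]
  have swap: "(LINT t|lborel. LINT v|lborel. ?F v t) = (LINT v|lborel. LINT t|lborel. ?F v t)"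
    and int_v: "integrable lborel (\<lambda>v. LINT t|lborel. ?F v t)"
    using lborel_pair.integrable_fst'[OF \<open>integrable (lborel \<Otimes>\<^sub>M lborel) (case_prod ?F)\<close>] by simp_all
  have "complex_of_real (LINT w|lborel. (cmod (fourier h w))\<^sup>2 * gaussian (e *\<^sub>R w))
      = (LINT w|lborel. fourier h w * k w)"
    unfolding integral_complex_of_real[symmetric]
    by (intro Bochner_Integration.integral_cong refl)
      (simp add: k_def complex_norm_square mult_ac del: of_real_power)
  also have "\<dots> = (LINT t|lborel. h t * fourier k t)"
    by (rule fourier_multiplication[OF h1 k])
  also have "\<dots> = (LINT t|lborel. LINT v|lborel. ?F v t)"
    unfolding k_hat by (simp add: mult.left_commute flip: integral_mult_right_zero)
  finally have "(LINT w|lborel. (cmod (fourier h w))\<^sup>2 * gaussian (e *\<^sub>R w))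
      = Re (LINT v|lborel. LINT t|lborel. ?F v t)"
    unfolding swap by (metis Re_complex_of_real)
  also have "\<dots> = (LINT v|lborel. Re (LINT t|lborel. ?F v t))"
    using integral_Re[OF int_v] by simp
  also have "\<dots> = (LINT v|lborel. gaussian v * Re (LINT t|lborel. h t * cnj (h (t + e *\<^sub>R v))))"
    by (intro Bochner_Integration.integral_cong refl) simp
  finally show "(LINT w|lborel. (cmod (fourier h w))\<^sup>2 * gaussian (e *\<^sub>R w))
      = (LINT v|lborel. gaussian v * Re (LINT t|lborel. h t * cnj (h (t + e *\<^sub>R v))))" .
qed

text \<open>As \<open>e\<close> decreases to \<open>0\<close> in the weighted identity, the left side converges by monotone convergence.
  The right side converges by dominated convergence: the autocorrelation tends to its value at \<open>0\<close>, is
  bounded by that value, and the Gaussian has integral \<open>1\<close>.\<close>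
theorem plancherel:
  fixes h :: "'a::euclidean_space \<Rightarrow> complex"
  assumes h1: "integrable lborel h" and h2: "h \<in> L2"
  shows "(\<integral>\<^sup>+w. ennreal ((cmod (fourier h w))\<^sup>2) \<partial>lborel) = (\<integral>\<^sup>+t. ennreal ((cmod (h t))\<^sup>2) \<partial>lborel)"
proof -
  note [measurable] = L2_measurable[OF h2] borel_measurable_fourier[OF L2_measurable[OF h2]]
  define N where "N = (LINT t|lborel. (cmod (h t))\<^sup>2)"
  define q where "q u = (LINT t|lborel. (cmod (h (t + u) - h t))\<^sup>2)" for u
  define e where "e k = 1 / real (Suc k)" for k
  have e_pos: "e k > 0" for k by (simp add: e_def)
  have e_lim: "e \<longlonglongrightarrow> 0"
    unfolding e_def[abs_def] by (rule LIMSEQ_Suc[OF lim_1_over_n])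
  have q_bounds: "0 \<le> q u" "q u \<le> 4 * N" for u
  proof -
    show "0 \<le> q u" by (simp add: q_def)
    have "q u \<le> (LINT t|lborel. 2 * (cmod (h (t + u)))\<^sup>2 + 2 * (cmod (h t))\<^sup>2)"
      unfolding q_def
    proof (rule integral_mono)
      show "(cmod (h (t + u) - h t))\<^sup>2 \<le> 2 * (cmod (h (t + u)))\<^sup>2 + 2 * (cmod (h t))\<^sup>2" for t
        using cmod_add_squared_le[of "h (t + u)" "- h t"] by simp
    qed (use L2_integrable_norm_square[OF h2] L2_integrable_norm_square[OF L2_translate[OF h2]]
          L2_integrable_norm_square[OF L2_diff[OF L2_translate[OF h2] h2]] in auto)
    also have "\<dots> = 4 * N"
      using L2_integrable_norm_square[OF h2] L2_integrable_norm_square[OF L2_translate[OF h2, of u]]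
        lborel_integral_translate[of "\<lambda>t. (cmod (h t))\<^sup>2" u]
      by (simp add: N_def)
    finally show "q u \<le> 4 * N" .
  qed
  have [measurable]: "q \<in> borel_measurable borel"
  proof -
    have "(\<lambda>u::'a. LINT t|lborel. (cmod (h (t + u) - h t))\<^sup>2) \<in> borel_measurable lborel"
      by measurable
    then show ?thesis by (simp add: q_def[abs_def])
  qed
  have "(\<lambda>k. LINT v|lborel. gaussian v * (N - q (e k *\<^sub>R v) / 2)) \<longlonglongrightarrow> (LINT v|lborel. gaussian (v::'a) * N)"
  proof (rule integral_dominated_convergence[where w = "\<lambda>v::'a. gaussian v * N"])
    show "integrable lborel (\<lambda>v::'a. gaussian v * N)"
      by (intro integrable_mult_left integrable_gaussian)
    show "AE v in lborel. (\<lambda>k. gaussian v * (N - q (e k *\<^sub>R v) / 2)) \<longlonglongrightarrow> gaussian (v::'a) * N"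
    proof (intro AE_I2)
      fix v :: 'a
      have "(\<lambda>k. e k *\<^sub>R v) \<longlonglongrightarrow> 0"
        using tendsto_scaleR[OF e_lim tendsto_const[of v]] by simp
      then have "(\<lambda>k. q (e k *\<^sub>R v)) \<longlonglongrightarrow> 0"
        unfolding q_def by (rule L2_translation_continuous[OF h2])
      then have "(\<lambda>k. gaussian v * (N - q (e k *\<^sub>R v) / 2)) \<longlonglongrightarrow> gaussian v * (N - 0 / 2)"
        by (intro tendsto_intros) auto
      then show "(\<lambda>k. gaussian v * (N - q (e k *\<^sub>R v) / 2)) \<longlonglongrightarrow> gaussian v * N" by simp
    qed
    show "AE v in lborel. norm (gaussian v * (N - q (e k *\<^sub>R v) / 2)) \<le> gaussian (v::'a) * N" for k
    proof (intro AE_I2)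
      fix v :: 'a
      have "\<bar>N - q (e k *\<^sub>R v) / 2\<bar> \<le> N"
        using q_bounds[of "e k *\<^sub>R v"] by (simp add: abs_le_iff)
      then show "norm (gaussian v * (N - q (e k *\<^sub>R v) / 2)) \<le> gaussian v * N"
        by (simp add: abs_mult mult_left_mono)
    qed
  qed measurable
  then have "(\<lambda>k. LINT w|lborel. (cmod (fourier h w))\<^sup>2 * gaussian (e k *\<^sub>R w)) \<longlonglongrightarrow> N"
    by (simp add: gaussian_weighted_plancherel[OF h1 h2 e_pos] Re_autocorrelation[OF h2] integral_gaussian
        flip: N_def q_def)
  then have "(\<lambda>k. ennreal (LINT w|lborel. (cmod (fourier h w))\<^sup>2 * gaussian (e k *\<^sub>R w))) \<longlonglongrightarrow> ennreal N"
    by (rule tendsto_ennrealI)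
  then have lim1: "(\<lambda>k. \<integral>\<^sup>+w. ennreal ((cmod (fourier h w))\<^sup>2 * gaussian (e k *\<^sub>R w)) \<partial>lborel) \<longlonglongrightarrow> ennreal N"
    by (subst nn_integral_eq_integral[OF gaussian_weighted_plancherel(1)[OF h1 h2 e_pos]]) simp_all
  have lim2: "(\<lambda>k. \<integral>\<^sup>+w. ennreal ((cmod (fourier h w))\<^sup>2 * gaussian (e k *\<^sub>R w)) \<partial>lborel)
      \<longlonglongrightarrow> (\<integral>\<^sup>+w. ennreal ((cmod (fourier h w))\<^sup>2) \<partial>lborel)"
  proof (rule nn_integral_LIMSEQ)
    show "incseq (\<lambda>k w. ennreal ((cmod (fourier h w))\<^sup>2 * gaussian (e k *\<^sub>R w)))"
    proof (intro incseq_SucI le_funI ennreal_leI mult_left_mono)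
      fix k and w :: 'a
      have "e (Suc k) \<le> e k" by (simp add: e_def frac_le)
      then show "gaussian (e k *\<^sub>R w) \<le> gaussian (e (Suc k) *\<^sub>R w)"
        using e_pos[of "Suc k"] e_pos[of k]
        by (simp add: gaussian_def power_mono mult_right_mono)
    qed simp
    show "(\<lambda>k. ennreal ((cmod (fourier h w))\<^sup>2 * gaussian (e k *\<^sub>R w))) \<longlonglongrightarrow> ennreal ((cmod (fourier h w))\<^sup>2)" for w
    proof (rule tendsto_ennrealI)
      have "(\<lambda>k. (cmod (fourier h w))\<^sup>2 * gaussian (e k *\<^sub>R w)) \<longlonglongrightarrow> (cmod (fourier h w))\<^sup>2 * gaussian (0 *\<^sub>R w)"
        unfolding gaussian_def using e_lim by (intro tendsto_intros)
      then show "(\<lambda>k. (cmod (fourier h w))\<^sup>2 * gaussian (e k *\<^sub>R w)) \<longlonglongrightarrow> (cmod (fourier h w))\<^sup>2"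
        by (simp add: gaussian_def)
    qed
  qed measurable
  have "(\<integral>\<^sup>+w. ennreal ((cmod (fourier h w))\<^sup>2) \<partial>lborel) = ennreal N"
    using LIMSEQ_unique[OF lim2 lim1] .
  then show ?thesis
    using nn_integral_eq_integral[OF L2_integrable_norm_square[OF h2]] by (simp add: N_def)
qed


section \<open>The short-time Fourier transform and Moyal's identity\<close>

lemma freq_shift_time_shift: "freq_shift \<omega> (time_shift x g) t = cnj (character (t \<bullet> \<omega>)) * g (t - x)"
  by (simp add: freq_shift_def time_shift_def character_def exp_cnj)

lemma L2_time_frequency_shift:
  assumes "g \<in> L2"
  shows "freq_shift \<omega> (time_shift x g) \<in> L2"
proof -
  have [measurable]: "(\<lambda>t. g (t - x)) \<in> borel_measurable borel"
    and int: "integrable lborel (\<lambda>t. (cmod (g (t - x)))\<^sup>2)"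
    using L2_translate[OF assms, of "- x"] by (simp_all add: L2_def)
  have "(\<lambda>t. cnj (character (t \<bullet> \<omega>)) * g (t - x)) \<in> L2"
    using int by (simp add: L2_def norm_mult)
  then show ?thesis
    by (simp add: freq_shift_time_shift[abs_def])
qed

lemma stft_eq_inner: "stft g f (x, \<omega>) = L2_inner f (freq_shift \<omega> (time_shift x g))"
  by (simp add: stft_def L2_inner_def freq_shift_time_shift character_def mult_ac)

lemma stft_eq_fourier: "stft g f (x, \<omega>) = fourier (\<lambda>t. f t * cnj (g (t - x))) \<omega>"
  by (simp add: stft_def fourier_def character_def)

lemma stft_add_scale:
  assumes "g \<in> L2" "f \<in> L2" "h \<in> L2"
  shows "stft g (\<lambda>t. f t + c * h t) = (\<lambda>p. stft g f p + c * stft g h p)"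
  using assms L2_time_frequency_shift[OF \<open>g \<in> L2\<close>]
  by (auto simp: stft_eq_inner L2_inner_add_left L2_scale L2_inner_scale_left)

lemma borel_measurable_stft:
  assumes [measurable]: "f \<in> borel_measurable borel" "g \<in> borel_measurable borel"
  shows "stft g f \<in> borel_measurable borel"
proof -
  have "(\<lambda>p. LINT t|lborel. f t * cnj (g (t - fst p)) * character (t \<bullet> snd p))
      \<in> borel_measurable (lborel \<Otimes>\<^sub>M lborel)"
    by measurable
  moreover have "stft g f = (\<lambda>p. LINT t|lborel. f t * cnj (g (t - fst p)) * character (t \<bullet> snd p))"
    by (auto simp: stft_def character_def)
  ultimately show ?thesis by (simp add: lborel_prod)
qed

text \<open>Plancherel's theorem applies on almost every slice \<open>x = const\<close>.  The slice function
  \<open>t \<mapsto> f(t) cnj (g(t - x))\<close> need not be square integrable for every \<open>x\<close>, but by Tonelli's theorem the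
  integral over \<open>x\<close> of its squared norm is \<open>\<parallel>f\<parallel>\<^sup>2 \<parallel>g\<parallel>\<^sup>2 < \<infinity>\<close>.\<close>
lemma nn_integral_stft:
  fixes f g :: "real^'n \<Rightarrow> complex"
  assumes f: "f \<in> L2" and g: "g \<in> L2"
  shows "(\<integral>\<^sup>+p. ennreal ((cmod (stft g f p))\<^sup>2) \<partial>lborel)
    = (\<integral>\<^sup>+t. ennreal ((cmod (f t))\<^sup>2) \<partial>lborel) * (\<integral>\<^sup>+t. ennreal ((cmod (g t))\<^sup>2) \<partial>lborel)"
proof -
  note [measurable] = L2_measurable[OF f] L2_measurable[OF g] borel_measurable_stft
  let ?N = "\<lambda>h::real^'n \<Rightarrow> complex. \<integral>\<^sup>+t. ennreal ((cmod (h t))\<^sup>2) \<partial>lborel"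
  define h where "h x t = f t * cnj (g (t - x))" for x t
  have slices: "(\<integral>\<^sup>+x. ?N (h x) \<partial>lborel) = ?N f * ?N g"
  proof -
    have "(\<integral>\<^sup>+x. ?N (h x) \<partial>lborel)
        = (\<integral>\<^sup>+t. \<integral>\<^sup>+x. ennreal ((cmod (f t))\<^sup>2) * ennreal ((cmod (g (t - x)))\<^sup>2) \<partial>lborel \<partial>lborel)"
      unfolding h_def
      by (subst lborel_pair.Fubini') (auto simp: norm_mult power_mult_distrib ennreal_mult)
    also have "\<dots> = (\<integral>\<^sup>+t. ennreal ((cmod (f t))\<^sup>2) * ?N g \<partial>lborel)"
    proof (intro nn_integral_cong)
      fix t
      have "(\<integral>\<^sup>+x. ennreal ((cmod (g (t - x)))\<^sup>2) \<partial>lborel) = ?N g"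
        using lborel_nn_integral_affine[of "\<lambda>s. ennreal ((cmod (g s))\<^sup>2)" "-1" t] by simp
      then show "(\<integral>\<^sup>+x. ennreal ((cmod (f t))\<^sup>2) * ennreal ((cmod (g (t - x)))\<^sup>2) \<partial>lborel)
          = ennreal ((cmod (f t))\<^sup>2) * ?N g"
        by (simp add: nn_integral_cmult)
    qed
    also have "\<dots> = ?N f * ?N g"
      by (simp add: nn_integral_multc)
    finally show ?thesis .
  qed
  have meas_h [measurable]: "h x \<in> borel_measurable borel" for x
    unfolding h_def[abs_def] by measurable
  have "(\<lambda>x. ?N (h x)) \<in> borel_measurable lborel"
    unfolding h_def by measurable
  moreover have "?N f < \<infinity>" "?N g < \<infinity>"
    using f g by (simp_all add: L2_iff_nn_integral_finite)
  then have "(\<integral>\<^sup>+x. ?N (h x) \<partial>lborel) \<noteq> \<infinity>"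
    unfolding slices by (simp add: ennreal_mult_eq_top_iff less_top)
  ultimately have fin: "AE x in lborel. ?N (h x) \<noteq> \<infinity>"
    by (rule nn_integral_noteq_infinite)
  have "(\<integral>\<^sup>+p. ennreal ((cmod (stft g f p))\<^sup>2) \<partial>lborel)
      = (\<integral>\<^sup>+x. \<integral>\<^sup>+w. ennreal ((cmod (stft g f (x, w)))\<^sup>2) \<partial>lborel \<partial>lborel)"
    unfolding lborel_prod[symmetric]
    by (rule sigma_finite_measure.nn_integral_fst[OF sigma_finite_lborel, symmetric]) (simp add: lborel_prod)
  also have "\<dots> = (\<integral>\<^sup>+x. ?N (h x) \<partial>lborel)"
  proof (rule nn_integral_cong_AE, use fin in eventually_elim)
    fix x
    assume "?N (h x) \<noteq> \<infinity>"
    then have "h x \<in> L2"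
      by (simp add: L2_iff_nn_integral_finite top.not_eq_extremum)
    moreover have "integrable lborel (h x)"
      unfolding h_def using L2_integrable_inner[OF f L2_translate[OF g, of "- x"]] by simp
    ultimately show "(\<integral>\<^sup>+w. ennreal ((cmod (stft g f (x, w)))\<^sup>2) \<partial>lborel) = ?N (h x)"
      using plancherel by (simp add: stft_eq_fourier flip: h_def)
  qed
  finally show ?thesis
    using slices by simp
qed

lemma
  assumes f: "f \<in> L2" and g: "g \<in> L2"
  shows stft_in_L2: "stft g f \<in> L2"
    and L2_norm_stft: "L2_norm (stft g f) = L2_norm f * L2_norm g"
proof -
  have eq: "(\<integral>\<^sup>+p. ennreal ((cmod (stft g f p))\<^sup>2) \<partial>lborel) = ennreal ((L2_norm f * L2_norm g)\<^sup>2)"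
    by (simp add: nn_integral_stft[OF f g] nn_integral_L2_norm f g power_mult_distrib flip: ennreal_mult)
  show stft: "stft g f \<in> L2"
    using borel_measurable_stft[OF L2_measurable[OF f] L2_measurable[OF g]]
    by (simp add: L2_iff_nn_integral_finite eq)
  have "(L2_norm (stft g f))\<^sup>2 = (L2_norm f * L2_norm g)\<^sup>2"
    using eq unfolding nn_integral_L2_norm[OF stft] by simp
  then show "L2_norm (stft g f) = L2_norm f * L2_norm g"
    by (simp add: L2_norm_nonneg)
qed

text \<open>Moyal's identity, by polarization of the norm identity; \<open>V\<^sub>g\<close> is linear.\<close>
lemma L2_inner_stft:
  assumes f: "f \<in> L2" and h: "h \<in> L2" and g: "g \<in> L2"
  shows "L2_inner (stft g f) (stft g h) = complex_of_real ((L2_norm g)\<^sup>2) * L2_inner f h"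
proof -
  have "4 * L2_inner (stft g f) (stft g h) = (\<Sum>c\<in>{1, -1, \<i>, -\<i>}.
      c * complex_of_real ((L2_norm (stft g (\<lambda>t. f t + c * h t)))\<^sup>2))"
    unfolding L2_inner_polarization[OF stft_in_L2[OF f g] stft_in_L2[OF h g]] stft_add_scale[OF g f h] ..
  also have "\<dots> = complex_of_real ((L2_norm g)\<^sup>2) * (\<Sum>c\<in>{1, -1, \<i>, -\<i>}.
      c * complex_of_real ((L2_norm (\<lambda>t. f t + c * h t))\<^sup>2))"
    unfolding L2_norm_stft[OF L2_add[OF f L2_scale[OF h]] g]
    by (simp add: sum_distrib_left power_mult_distrib mult_ac)
  also have "\<dots> = complex_of_real ((L2_norm g)\<^sup>2) * (4 * L2_inner f h)"
    unfolding L2_inner_polarization[OF f h] ..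
  finally show ?thesis by simp
qed


section \<open>Completeness\<close>

text \<open>The increments are absolutely summable, because \<open>2 a \<le> 2\<^sup>-\<^sup>k + 2\<^sup>k a\<^sup>2\<close> for every real \<open>a\<close>.  The weighted
  squares are used because their sum can be integrated term by term when only \<open>L\<^sup>2\<close> norms are
  controlled.\<close>
lemma convergent_if_summable_increments:
  fixes x :: "nat \<Rightarrow> complex"
  assumes "summable (\<lambda>k. 2 ^ k * (cmod (x (Suc k) - x k))\<^sup>2)"
  shows "convergent x"
proof -
  have "summable (\<lambda>k. x (Suc k) - x k)"
  proof (rule summable_comparison_test')
    show "summable (\<lambda>k. (1/2) ^ k + 2 ^ k * (cmod (x (Suc k) - x k))\<^sup>2)"
      using assms by (intro summable_add summable_geometric) auto
    fix k
    define a where "a = cmod (x (Suc k) - x k)"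
    have "0 \<le> 2 ^ k * ((1/2) ^ k - a)\<^sup>2" by simp
    also have "\<dots> = (1/2) ^ k - 2 * a + 2 ^ k * a\<^sup>2"
      by (simp add: power2_eq_square algebra_simps power_divide)
    finally have "2 * a \<le> (1/2) ^ k + 2 ^ k * a\<^sup>2" by simp
    moreover have "0 \<le> a" by (simp add: a_def)
    ultimately show "norm (x (Suc k) - x k) \<le> (1/2) ^ k + 2 ^ k * (cmod (x (Suc k) - x k))\<^sup>2"
      unfolding a_def by linarith
  qed
  then have "convergent (\<lambda>n. \<Sum>k<n. x (Suc k) - x k)"
    by (simp add: summable_iff_convergent)
  then have "convergent (\<lambda>n. (x n - x 0) + x 0)"
    unfolding sum_lessThan_telescope by (rule convergent_add[OF _ convergent_const])
  then show ?thesis by simp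
qed

text \<open>The Riesz-Fischer theorem.  A subsequence whose increments have geometrically small norms converges
  almost everywhere, and Fatou's lemma shows that the whole sequence converges in norm to its limit.\<close>
theorem L2_complete:
  fixes F :: "nat \<Rightarrow> 'a::euclidean_space \<Rightarrow> complex"
  assumes F: "\<And>n. F n \<in> L2"
    and Cauchy: "\<And>e. e > 0 \<Longrightarrow> \<exists>N. \<forall>m\<ge>N. \<forall>n\<ge>N. L2_norm (\<lambda>t. F m t - F n t) < e"
  shows "\<exists>f\<in>L2. (\<lambda>n. L2_norm (\<lambda>t. F n t - f t)) \<longlonglongrightarrow> 0"
proof -
  note [measurable] = L2_measurable[OF F]
  have "\<forall>k. \<exists>N. \<forall>m\<ge>N. \<forall>n\<ge>N. L2_norm (\<lambda>t. F m t - F n t) < (1/2) ^ k"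
    by (intro allI Cauchy) simp
  then obtain N where N: "\<And>k m n. m \<ge> N k \<Longrightarrow> n \<ge> N k \<Longrightarrow> L2_norm (\<lambda>t. F m t - F n t) < (1/2) ^ k"
    by metis
  \<comment> \<open>The sum makes \<open>r\<close> monotone, so \<open>r k\<close> and \<open>r (Suc k)\<close> are both at least \<open>N k\<close>; the summand \<open>k\<close> makes
    it unbounded.\<close>
  define r where "r k = k + (\<Sum>i\<le>k. N i)" for k
  have r: "r k \<ge> N k" "r (Suc k) \<ge> N k" "r k \<ge> k" for k
    using member_le_sum[of k "{..k}" N] by (simp_all add: r_def)
  \<comment> \<open>The weight \<open>2\<^sup>k\<close> still leaves integrals at most \<open>2\<^sup>k 4\<^sup>-\<^sup>k = 2\<^sup>-\<^sup>k\<close>.\<close>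
  define d where "d k t = 2 ^ k * (cmod (F (r (Suc k)) t - F (r k) t))\<^sup>2" for k t
  have [measurable]: "d k \<in> borel_measurable borel" for k
    unfolding d_def[abs_def] by measurable
  have "(\<integral>\<^sup>+t. ennreal (d k t) \<partial>lborel) \<le> ennreal ((1/2) ^ k)" for k
  proof -
    let ?n = "L2_norm (\<lambda>t. F (r (Suc k)) t - F (r k) t)"
    have "?n\<^sup>2 \<le> ((1/2) ^ k)\<^sup>2"
      using N[OF r(2) r(1)] by (intro power_mono less_imp_le L2_norm_nonneg)
    then have "2 ^ k * ?n\<^sup>2 \<le> 2 ^ k * ((1/2) ^ k)\<^sup>2" by simp
    also have "\<dots> = (1/2::real) ^ k"
      by (simp add: power2_eq_square power_divide)
    finally have "2 ^ k * ?n\<^sup>2 \<le> (1/2) ^ k" .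
    moreover have "(\<integral>\<^sup>+t. ennreal (d k t) \<partial>lborel) = ennreal (2 ^ k * ?n\<^sup>2)"
      unfolding d_def using nn_integral_L2_norm[OF L2_diff[OF F F]]
      by (simp add: ennreal_mult nn_integral_cmult)
    ultimately show ?thesis by (simp add: ennreal_leI)
  qed
  then have "(\<Sum>k. \<integral>\<^sup>+t. ennreal (d k t) \<partial>lborel) \<le> (\<Sum>k. ennreal ((1/2) ^ k))"
    by (intro suminf_le) auto
  also have "\<dots> = ennreal (\<Sum>k. (1/2) ^ k)"
    by (intro suminf_ennreal2 summable_geometric) auto
  finally have "(\<integral>\<^sup>+t. (\<Sum>k. ennreal (d k t)) \<partial>lborel) \<noteq> \<infinity>"
    by (subst nn_integral_suminf) (auto simp: top_unique)
  then have "AE t in lborel. (\<Sum>k. ennreal (d k t)) \<noteq> \<infinity>"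
    by (intro nn_integral_noteq_infinite) measurable
  then have conv: "AE t in lborel. convergent (\<lambda>k. F (r k) t)"
  proof eventually_elim
    fix t
    assume "(\<Sum>k. ennreal (d k t)) \<noteq> \<infinity>"
    then have "summable (\<lambda>k. d k t)"
      by (intro summable_suminf_not_top) (auto simp: d_def)
    then show "convergent (\<lambda>k. F (r k) t)"
      unfolding d_def by (rule convergent_if_summable_increments)
  qed
  define f where "f t = lim (\<lambda>k. F (r k) t)" for t
  have [measurable]: "f \<in> borel_measurable borel"
    unfolding f_def[abs_def] by measurable
  have close: "(\<integral>\<^sup>+t. ennreal ((cmod (F n t - f t))\<^sup>2) \<partial>lborel) \<le> ennreal (e\<^sup>2)"
    if M: "\<And>m. m \<ge> M \<Longrightarrow> L2_norm (\<lambda>t. F n t - F m t) < e" for n M e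
  proof -
    have "(\<integral>\<^sup>+t. ennreal ((cmod (F n t - f t))\<^sup>2) \<partial>lborel)
        = (\<integral>\<^sup>+t. liminf (\<lambda>k. ennreal ((cmod (F n t - F (r k) t))\<^sup>2)) \<partial>lborel)"
    proof (rule nn_integral_cong_AE, use conv in eventually_elim)
      fix t
      assume "convergent (\<lambda>k. F (r k) t)"
      then have "(\<lambda>k. F (r k) t) \<longlonglongrightarrow> f t"
        by (simp add: f_def convergent_LIMSEQ_iff)
      then have "(\<lambda>k. ennreal ((cmod (F n t - F (r k) t))\<^sup>2)) \<longlonglongrightarrow> ennreal ((cmod (F n t - f t))\<^sup>2)"
        by (intro tendsto_ennrealI tendsto_intros)
      then show "ennreal ((cmod (F n t - f t))\<^sup>2) = liminf (\<lambda>k. ennreal ((cmod (F n t - F (r k) t))\<^sup>2))"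
        by (intro lim_imp_Liminf[symmetric]) auto
    qed
    also have "\<dots> \<le> liminf (\<lambda>k. \<integral>\<^sup>+t. ennreal ((cmod (F n t - F (r k) t))\<^sup>2) \<partial>lborel)"
      by (rule nn_integral_liminf) measurable
    also have "\<dots> \<le> limsup (\<lambda>k. \<integral>\<^sup>+t. ennreal ((cmod (F n t - F (r k) t))\<^sup>2) \<partial>lborel)"
      by (rule Liminf_le_Limsup) simp
    also have "\<dots> \<le> ennreal (e\<^sup>2)"
    proof (rule Limsup_bounded)
      show "\<forall>\<^sub>F k in sequentially. (\<integral>\<^sup>+t. ennreal ((cmod (F n t - F (r k) t))\<^sup>2) \<partial>lborel) \<le> ennreal (e\<^sup>2)"
        using eventually_ge_at_top[of M]
      proof eventually_elim
        fix k
        assume "k \<ge> M"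
        then have "L2_norm (\<lambda>t. F n t - F (r k) t) < e"
          using r(3)[of k] by (intro M) simp
        then have "(L2_norm (\<lambda>t. F n t - F (r k) t))\<^sup>2 \<le> e\<^sup>2"
          by (intro power_mono less_imp_le L2_norm_nonneg)
        then show "(\<integral>\<^sup>+t. ennreal ((cmod (F n t - F (r k) t))\<^sup>2) \<partial>lborel) \<le> ennreal (e\<^sup>2)"
          by (simp add: nn_integral_L2_norm[OF L2_diff[OF F F]] ennreal_leI)
      qed
    qed
    finally show ?thesis .
  qed
  have in_L2: "(\<lambda>t. F n t - f t) \<in> L2"
    if "\<And>m. m \<ge> M \<Longrightarrow> L2_norm (\<lambda>t. F n t - F m t) < e" for n M e
    using order_le_less_trans[OF close[of M n e, OF that] ennreal_less_top] by (simp add: L2_iff_nn_integral_finite)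
  obtain M where M: "\<And>m n. m \<ge> M \<Longrightarrow> n \<ge> M \<Longrightarrow> L2_norm (\<lambda>t. F m t - F n t) < 1"
    using Cauchy[of 1] by auto
  \<comment> \<open>Only the difference \<open>F M - f\<close> is controlled by Fatou's lemma; \<open>f\<close> is recovered from it.\<close>
  have "(\<lambda>t. F M t - (F M t - f t)) \<in> L2"
    by (intro L2_diff F in_L2[OF M[OF order_refl]])
  then have f: "f \<in> L2" by simp
  have "(\<lambda>n. L2_norm (\<lambda>t. F n t - f t)) \<longlonglongrightarrow> 0"
  proof (rule LIMSEQ_I)
    fix e :: real
    assume "e > 0"
    then obtain K where K: "\<And>m n. m \<ge> K \<Longrightarrow> n \<ge> K \<Longrightarrow> L2_norm (\<lambda>t. F m t - F n t) < e / 2"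
      using Cauchy[of "e / 2"] by auto
    have "L2_norm (\<lambda>t. F n t - f t) < e" if "n \<ge> K" for n
    proof -
      have "(L2_norm (\<lambda>t. F n t - f t))\<^sup>2 \<le> (e / 2)\<^sup>2"
        using close[of K n "e / 2", OF K[OF that]] unfolding nn_integral_L2_norm[OF L2_diff[OF F f]] by simp
      then have "L2_norm (\<lambda>t. F n t - f t) \<le> e / 2"
        by (rule power2_le_imp_le) (use \<open>e > 0\<close> in simp)
      then show ?thesis using \<open>e > 0\<close> by simp
    qed
    then show "\<exists>no. \<forall>n\<ge>no. norm (L2_norm (\<lambda>t. F n t - f t) - 0) < e"
      by (auto simp: L2_norm_nonneg)
  qed
  with f show ?thesis by blast
qed


section \<open>Gram matrices\<close>

lemma L2_norm_square_expand:
  assumes "\<And>i. i \<in> S \<Longrightarrow> \<phi> i \<in> L2"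
  shows "(\<Sum>x\<in>S. \<Sum>y\<in>S. cnj (c x) * L2_inner (\<phi> y) (\<phi> x) * c y)
    = complex_of_real ((L2_norm (\<lambda>t. \<Sum>i\<in>S. c i * \<phi> i t))\<^sup>2)"
  unfolding L2_inner_self_norm[symmetric]
  by (subst L2_inner_sum_right)
    (auto simp: assms L2_sum L2_inner_sum_left sum_distrib_left sum_distrib_right mult_ac intro!: sum.cong)

lemma strictly_positive_definite_Gram_iff:
  assumes "\<And>i. i \<in> S \<Longrightarrow> \<phi> i \<in> L2"
  shows "strictly_positive_definite_on S (\<lambda>x y. L2_inner (\<phi> y) (\<phi> x)) \<longleftrightarrow>
    (\<forall>c. (AE t in lborel. (\<Sum>i\<in>S. c i * \<phi> i t) = 0) \<longrightarrow> (\<forall>i\<in>S. c i = 0))"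
proof -
  have "0 < (L2_norm (\<lambda>t. \<Sum>i\<in>S. c i * \<phi> i t))\<^sup>2 \<longleftrightarrow> \<not> (AE t in lborel. (\<Sum>i\<in>S. c i * \<phi> i t) = 0)" for c
    using L2_norm_eq_0_iff[OF L2_sum, of S \<phi> c] assms by simp
  moreover have "(\<Sum>x\<in>S. \<Sum>y\<in>S. cnj (c x) * L2_inner (\<phi> y) (\<phi> x) * c y)
      = complex_of_real ((L2_norm (\<lambda>t. \<Sum>i\<in>S. c i * \<phi> i t))\<^sup>2)" for c
    using assms by (rule L2_norm_square_expand)
  ultimately show ?thesis
    unfolding strictly_positive_definite_on_def
    by (simp only: Re_complex_of_real Reals_of_real simp_thms) blast
qed


section \<open>Gabor spaces as reproducing kernel Hilbert spaces\<close>

lemma ip_dist_stft: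
  assumes f: "f \<in> L2" and h: "h \<in> L2" and g: "g \<in> L2" "L2_norm g = 1"
  shows "ip_dist L2_inner (stft g f) (stft g h) = L2_norm (\<lambda>t. f t - h t)"
proof -
  have "(\<lambda>p. stft g f p - stft g h p) = stft g (\<lambda>t. f t - h t)"
    using stft_add_scale[OF g(1) f h, of "-1"] by simp
  then show ?thesis
    using L2_norm_stft[OF L2_diff[OF f h] g(1)] g(2)
    by (simp add: ip_dist_def L2_inner_self_norm L2_norm_nonneg)
qed

text \<open>Definiteness for pointwise equality: if \<open>\<parallel>V\<^sub>g f\<parallel> = \<parallel>f\<parallel> = 0\<close>, then \<open>f\<close> vanishes almost everywhere and the
  integrals defining \<open>V\<^sub>g f\<close> vanish at every point.\<close>
lemma inner_product_on_gabor_space: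
  assumes g: "g \<in> L2" "L2_norm g = 1"
  shows "inner_product_on (gabor_space g) L2_inner"
  unfolding inner_product_on_def
proof (intro conjI ballI allI impI)
  fix F G assume "F \<in> gabor_space g" "G \<in> gabor_space g"
  show "L2_inner G F = cnj (L2_inner F G)" by (rule L2_inner_commute)
next
  fix F G E assume "F \<in> gabor_space g" "G \<in> gabor_space g" "E \<in> gabor_space g"
  then have "F \<in> L2" "G \<in> L2" "E \<in> L2"
    using stft_in_L2[OF _ g(1)] by (auto simp: gabor_space_def)
  then show "L2_inner (\<lambda>x. F x + G x) E = L2_inner F E + L2_inner G E"
    by (rule L2_inner_add_left)
next
  fix F E c
  show "L2_inner (\<lambda>x. c * F x) E = c * L2_inner F E" by (rule L2_inner_scale_left)
next
  fix F assume "F \<in> gabor_space g" and nz: "F \<noteq> (\<lambda>x. 0)"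
  then obtain f where f: "f \<in> L2" "F = stft g f" by (auto simp: gabor_space_def)
  have "L2_norm f \<noteq> 0"
  proof
    assume "L2_norm f = 0"
    then have "AE t in lborel. f t = 0" using L2_norm_eq_0_iff[OF f(1)] by simp
    then have "L2_inner f k = 0" for k
      unfolding L2_inner_def by (intro integral_eq_zero_AE) auto
    then show False using nz by (auto simp: f(2) stft_eq_inner)
  qed
  then have "0 < (L2_norm F)\<^sup>2"
    using L2_norm_stft[OF f(1) g(1)] g(2) by (simp add: f(2))
  then show "L2_inner F F \<in> \<real>" "0 < Re (L2_inner F F)"
    by (simp_all add: L2_inner_self_norm)
qed

text \<open>Linear operations and Cauchy sequences are pulled back to \<open>L\<^sup>2\<close> along the isometry \<open>V\<^sub>g\<close>.\<close>
lemma hilbert_function_space_gabor: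
  assumes g: "g \<in> L2" "L2_norm g = 1"
  shows "hilbert_function_space (gabor_space g) L2_inner"
  unfolding hilbert_function_space_def
proof (intro conjI ballI allI impI)
  have "stft g (\<lambda>t. 0) = (\<lambda>p. 0)" by (auto simp: stft_def)
  then show "(\<lambda>p. 0) \<in> gabor_space g"
    using L2_zero unfolding gabor_space_def by (metis (mono_tags, lifting) mem_Collect_eq)
next
  fix F G assume "F \<in> gabor_space g" "G \<in> gabor_space g"
  then obtain f h where "f \<in> L2" "F = stft g f" "h \<in> L2" "G = stft g h"
    by (auto simp: gabor_space_def)
  then have "(\<lambda>p. F p + G p) = stft g (\<lambda>t. f t + h t)" "(\<lambda>t. f t + h t) \<in> L2"
    using stft_add_scale[OF g(1), of f h 1] by (auto intro: L2_add)
  then show "(\<lambda>p. F p + G p) \<in> gabor_space g"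
    by (auto simp: gabor_space_def)
next
  fix F c assume "F \<in> gabor_space g"
  then obtain f where f: "f \<in> L2" "F = stft g f" by (auto simp: gabor_space_def)
  then have "(\<lambda>p. c * F p) = stft g (\<lambda>t. c * f t)"
    by (auto simp: stft_eq_inner L2_inner_scale_left)
  then show "(\<lambda>p. c * F p) \<in> gabor_space g"
    using L2_scale[OF f(1)] by (auto simp: gabor_space_def)
next
  show "inner_product_on (gabor_space g) L2_inner"
    by (rule inner_product_on_gabor_space[OF g])
next
  fix F :: "nat \<Rightarrow> _"
  assume *: "(\<forall>n. F n \<in> gabor_space g) \<and>
      (\<forall>e>0. \<exists>N. \<forall>m\<ge>N. \<forall>n\<ge>N. ip_dist L2_inner (F m) (F n) < e)"
  then have "\<forall>n. \<exists>f. f \<in> L2 \<and> F n = stft g f" by (auto simp: gabor_space_def)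
  then obtain \<Phi> where \<Phi>: "\<And>n. \<Phi> n \<in> L2" "\<And>n. F n = stft g (\<Phi> n)" by metis
  have "\<exists>N. \<forall>m\<ge>N. \<forall>n\<ge>N. L2_norm (\<lambda>t. \<Phi> m t - \<Phi> n t) < e" if "e > 0" for e
    using *[THEN conjunct2, rule_format, OF that] unfolding \<Phi>(2) ip_dist_stft[OF \<Phi>(1) \<Phi>(1) g] .
  from L2_complete[OF \<Phi>(1) this] obtain f where
    f: "f \<in> L2" "(\<lambda>n. L2_norm (\<lambda>t. \<Phi> n t - f t)) \<longlonglongrightarrow> 0" by blast
  then show "\<exists>G\<in>gabor_space g. (\<lambda>n. ip_dist L2_inner (F n) G) \<longlonglongrightarrow> 0"
    by (intro bexI[of _ "stft g f"]) (auto simp: \<Phi> ip_dist_stft g gabor_space_def)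
qed

text \<open>\<open>V\<^sub>g f(x, \<omega>)\<close> is the inner product of \<open>f\<close> with the shifted window; Moyal's identity carries this inner
  product over to the Gabor space.\<close>
lemma represents_evaluation_gabor:
  assumes g: "g \<in> L2" "L2_norm g = 1"
  shows "represents_evaluation (gabor_space g) L2_inner (x, \<omega>) (stft g (freq_shift \<omega> (time_shift x g)))"
  unfolding represents_evaluation_def
  using L2_time_frequency_shift[OF g(1)] g
  by (auto simp: gabor_space_def L2_inner_stft stft_eq_inner)

lemma rkhs_gabor:
  assumes "g \<in> L2" "L2_norm g = 1"
  shows "rkhs (gabor_space g) L2_inner"
  unfolding rkhs_def
  using hilbert_function_space_gabor[OF assms] represents_evaluation_gabor[OF assms]
  by (metis surj_pair)

lemma reproducing_kernel_gabor:
  assumes g: "g \<in> L2" "L2_norm g = 1"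
  shows "reproducing_kernel (gabor_space g) L2_inner p q
    = L2_inner ((\<lambda>(x, \<omega>). freq_shift \<omega> (time_shift x g)) q) ((\<lambda>(x, \<omega>). freq_shift \<omega> (time_shift x g)) p)"
proof -
  have "point_kernel (gabor_space g) L2_inner p = stft g ((\<lambda>(x, \<omega>). freq_shift \<omega> (time_shift x g)) p)" for p
    using point_kernel_eqI[OF rkhs_gabor[OF g] represents_evaluation_gabor[OF g]] by (cases p) simp
  then show ?thesis
    using L2_inner_stft[OF L2_time_frequency_shift[OF g(1)] L2_time_frequency_shift[OF g(1)] g(1)] g(2)
    by (simp add: reproducing_kernel_def split: prod.split)
qed


section \<open>Interpolation and linear independence\<close>

theorem fully_interpolating_gabor_iff:
  assumes g: "g \<in> L2" "L2_norm g = 1"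
  shows "fully_interpolating (gabor_space g) L2_inner \<longleftrightarrow>
    L2_lin_independent (\<lambda>(x, \<omega>). freq_shift \<omega> (time_shift x g))"
proof -
  let ?\<phi> = "\<lambda>(x, \<omega>). freq_shift \<omega> (time_shift x g)"
  have "?\<phi> p \<in> L2" for p
    using L2_time_frequency_shift[OF g(1)] by (cases p) simp
  then have "strictly_positive_definite_on S (reproducing_kernel (gabor_space g) L2_inner) \<longleftrightarrow>
      (\<forall>c. (AE t in lborel. (\<Sum>i\<in>S. c i * ?\<phi> i t) = 0) \<longrightarrow> (\<forall>i\<in>S. c i = 0))" for S
    using strictly_positive_definite_Gram_iff[of S ?\<phi>]
    unfolding reproducing_kernel_gabor[OF g, abs_def] by blast
  then show ?thesis
    unfolding fully_interpolating_def L2_lin_independent_def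
    using rkhs_gabor[OF g] by blast
qed

lemma L2_lin_independent_scale:
  assumes "L2_lin_independent (\<lambda>i t. a * \<phi> i t)"
  shows "L2_lin_independent \<phi>"
  unfolding L2_lin_independent_def
proof (intro allI impI)
  fix S c
  assume "finite S" and zero: "AE t in lborel. (\<Sum>i\<in>S. c i * \<phi> i t) = 0"
  have "(\<Sum>i\<in>S. c i * (a * \<phi> i t)) = a * (\<Sum>i\<in>S. c i * \<phi> i t)" for t
    by (simp add: sum_distrib_left mult_ac)
  then have "AE t in lborel. (\<Sum>i\<in>S. c i * (a * \<phi> i t)) = 0"
    using zero by simp
  then show "\<forall>i\<in>S. c i = 0"
    using assms \<open>finite S\<close> unfolding L2_lin_independent_def by blast
qed

theorem proposition6p1:
  shows "(\<forall>g :: real^'n \<Rightarrow> complex. g \<in> L2 \<and> L2_nonzero g \<longrightarrow>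
            L2_lin_independent (\<lambda>(x, \<omega>). freq_shift \<omega> (time_shift x g)))
     \<longleftrightarrow> (\<forall>g :: real^'n \<Rightarrow> complex. g \<in> L2 \<and> L2_norm g = 1 \<longrightarrow>
            fully_interpolating (gabor_space g) L2_inner)"
proof (intro iffI allI impI; elim conjE)
  fix g :: "real^'n \<Rightarrow> complex"
  assume HRT: "\<forall>g :: real^'n \<Rightarrow> complex. g \<in> L2 \<and> L2_nonzero g \<longrightarrow>
      L2_lin_independent (\<lambda>(x, \<omega>). freq_shift \<omega> (time_shift x g))"
    and g: "g \<in> L2" "L2_norm g = 1"
  have "L2_nonzero g"
    using L2_norm_eq_0_iff[OF g(1)] g(2) by (simp add: L2_nonzero_def)
  then show "fully_interpolating (gabor_space g) L2_inner"
    using HRT g by (simp add: fully_interpolating_gabor_iff)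
next
  fix g :: "real^'n \<Rightarrow> complex"
  assume interp: "\<forall>g :: real^'n \<Rightarrow> complex. g \<in> L2 \<and> L2_norm g = 1 \<longrightarrow>
      fully_interpolating (gabor_space g) L2_inner"
    and g: "g \<in> L2" "L2_nonzero g"
  define a where "a = complex_of_real (1 / L2_norm g)"
  define g' where "g' t = a * g t" for t
  have "L2_norm g \<noteq> 0"
    using L2_norm_eq_0_iff[OF g(1)] g(2) by (simp add: L2_nonzero_def)
  then have g': "g' \<in> L2" "L2_norm g' = 1"
    using L2_scale[OF g(1), of a] L2_norm_scale[of a g] L2_norm_nonneg[of g]
    by (simp_all add: g'_def[abs_def] a_def norm_divide)
  then have "L2_lin_independent (\<lambda>(x, \<omega>). freq_shift \<omega> (time_shift x g'))"
    using interp fully_interpolating_gabor_iff by blast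
  also have "(\<lambda>(x, \<omega>). freq_shift \<omega> (time_shift x g'))
      = (\<lambda>p t. a * (\<lambda>(x, \<omega>). freq_shift \<omega> (time_shift x g)) p t)"
    by (auto simp: fun_eq_iff freq_shift_def time_shift_def g'_def)
  finally show "L2_lin_independent (\<lambda>(x, \<omega>). freq_shift \<omega> (time_shift x g))"
    by (rule L2_lin_independent_scale)
qed

end
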